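(* Let $p=p(n)$, $m=\binom n2 p$ and $d=(n-2)p^2$, and suppose $d\to\infty$ as $n\to\infty$. Then $\nu(G_{n,p})\sim m/3$ with high probability; that is, for every $\varepsilon>0$, $\Pr\big(|\nu(G_{n,p})-m/3|\le\varepsilon m\big)\to1$ as $n\to\infty$.
   Context: $G_{n,p}$ is the binomial random graph on vertex set $[n]$ in which each of the $\binom n2$ possible edges is present independently with probability $p$. For a finite graph $H$, $\nu(H)$ is the maximum number of pairwise edge-disjoint triangles in $H$. *)

theory Defs
  imports "HOL-Probability.Probability" "HOL-Probability.Product_PMF"
begin

(* A simple graph is a pair (V, E) of a vertex set and a set of two-element subsets of V. *)
type_synonym 'a graph = "'a set \<times> 'a set set"

definition vertex_pairs :: "'a set \<Rightarrow> 'a set set" where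
  "vertex_pairs S = {e. e \<subseteq> S \<and> card e = 2}"

(* A triangle is identified with its set of three vertices t; its edge set is vertex_pairs t. *)
definition triangles :: "'a graph \<Rightarrow> 'a set set" where
  "triangles H = {t. t \<subseteq> fst H \<and> card t = 3 \<and> vertex_pairs t \<subseteq> snd H}"

definition edge_disjoint_triangles :: "'a graph \<Rightarrow> 'a set set \<Rightarrow> bool" where
  "edge_disjoint_triangles H T \<longleftrightarrow>
     T \<subseteq> triangles H \<and> pairwise (\<lambda>s t. disjnt (vertex_pairs s) (vertex_pairs t)) T"

(* Meaningful when H has finitely many vertices; see the lemma below. *)
definition triangle_packing_number :: "'a graph \<Rightarrow> nat" where
  "triangle_packing_number H = Max {card T | T. edge_disjoint_triangles H T}"

lemma triangle_packing_number_Max_defined: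
  assumes "finite (fst H)"
  shows "finite {card T | T. edge_disjoint_triangles H T}"
    and "{card T | T. edge_disjoint_triangles H T} \<noteq> {}"
proof -
  have "triangles H \<subseteq> Pow (fst H)"
    by (auto simp: triangles_def)
  with assms have "finite (Pow (triangles H))"
    by (simp add: finite_subset)
  moreover have "{card T | T. edge_disjoint_triangles H T} \<subseteq> card ` Pow (triangles H)"
    by (auto simp: edge_disjoint_triangles_def)
  ultimately show "finite {card T | T. edge_disjoint_triangles H T}"
    by (meson finite_imageI finite_subset)
  have "edge_disjoint_triangles H {}"
    by (simp add: edge_disjoint_triangles_def)
  then show "{card T | T. edge_disjoint_triangles H T} \<noteq> {}"
    by blast
qed

(* bernoulli_pmf truncates its argument to the unit interval, so this is G(n,q) only for
   q in [0,1]. The second argument of Pi_pmf is the value of the indicator off the index set. *)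
definition binomial_random_graph :: "nat \<Rightarrow> real \<Rightarrow> nat graph pmf" where
  "binomial_random_graph n q =
     map_pmf (\<lambda>f. ({1..n}, {e \<in> vertex_pairs {1..n}. f e}))
       (Pi_pmf (vertex_pairs {1..n}) False (\<lambda>_. bernoulli_pmf q))"

end

(* Split the vertex set into N classes of size q. The triples {i,j,k} of class indices with
   N dvd i + j + k cover every pair of classes at most once and almost all pairs once, so it suffices
   to pack triangles in random tripartite graphs with classes A, B, C of size q.

   There, go through the vertices of A one at a time, keeping the set L of the edges between B and C
   that have not been used. The neighbourhoods of the next vertex a in B and in C are random sets
   independent of L, hence the part of L between them is almost regular of large degree as soon as L
   is almost regular; by Koenig's theorem it has an almost perfect matching, which together with a
   gives triangles, and whose edges are removed from L. Each vertex of B and C loses one edge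
   for almost every neighbour in A, and so L remains almost regular. Only first absolute moments of
   binomial variables are needed, and the expected shortfall obeys a linear recurrence.

   Finally nu(G) is at most a third of the number of edges, so that a lower bound on the expectation of
   nu(G) gives the concentration by Markov's inequality. *)
theory Submission
  imports Defs "HOL-Real_Asymp.Real_Asymp"
begin

section \<open>Expectation over random subsets\<close>

text \<open>The obstacle is that \<open>d\<close> may tend to infinity arbitrarily slowly. In the
  part of L between the two neighbourhoods of a vertex the degrees are only of order
  \<open>d\<close>, so they need not be near their mean at all vertices simultaneously, and no
  useful bound on the maximum degree is available. Koenig's theorem tolerates this: k vertices cover
  at most \<open>D * k\<close> edges plus the total excess of the degrees over \<open>D\<close>, and
  this total is small in expectation. The recurrence for the shortfall divides by the number
  \<open>q - t\<close> of vertices of A still to come, so the process is stopped while a fraction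
  1/N of A remains. The loss is then of order \<open>N * q * sqrt q\<close>, against about
  \<open>p * q^2\<close> triangles. For fixed N the ratio \<open>N / (p * sqrt q)\<close> tends to 0
  precisely because \<open>n * p^2\<close> tends to infinity.\<close>

definition bexp :: "real \<Rightarrow> 'a set \<Rightarrow> ('a set \<Rightarrow> real) \<Rightarrow> real" where
  "bexp p S F = measure_pmf.expectation (Pi_pmf S False (\<lambda>_. bernoulli_pmf p)) (\<lambda>f. F {e \<in> S. f e})"

context
  fixes p :: real
  assumes p01: "0 \<le> p" "p \<le> 1"
begin

lemma bexp_empty [simp]: "bexp p {} F = F {}"
  by (simp add: bexp_def)

text \<open>Conditions on whether \<open>e\<close> is chosen. With \<open>bexp_empty\<close> this
  recursion determines \<open>bexp\<close> on finite sets, so the calculus of expectations follows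
  by induction on \<open>S\<close>, with no integrability to check.\<close>

lemma bexp_insert:
  assumes "finite S" "e \<notin> S"
  shows "bexp p (insert e S) F = p * bexp p S (\<lambda>X. F (insert e X)) + (1 - p) * bexp p S F"
proof -
  let ?P = "Pi_pmf S False (\<lambda>_. bernoulli_pmf p)"
  have fin: "finite (set_pmf (Pi_pmf S False (\<lambda>_. bernoulli_pmf p)))"
    using assms(1) by (simp add: set_Pi_pmf finite_PiE_dflt)
  have "Pi_pmf (insert e S) False (\<lambda>_. bernoulli_pmf p)
        = bind_pmf (bernoulli_pmf p) (\<lambda>y. map_pmf (\<lambda>f. f(e := y)) ?P)"
    using assms by (simp add: Pi_pmf_insert' map_pmf_def)
  then have "bexp p (insert e S) F
      = measure_pmf.expectation (bind_pmf (bernoulli_pmf p) (\<lambda>y. map_pmf (\<lambda>f. f(e := y)) ?P))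
          (\<lambda>f. F {x \<in> insert e S. f x})"
    by (simp add: bexp_def)
  also have "\<dots> = p * measure_pmf.expectation ?P (\<lambda>f. F {x \<in> insert e S. (f(e := True)) x})
      + (1 - p) * measure_pmf.expectation ?P (\<lambda>f. F {x \<in> insert e S. (f(e := False)) x})"
    using p01 fin
    by (subst pmf_expectation_bind[where A = UNIV]) (auto simp: UNIV_bool)
  also have "(\<lambda>f. F {x \<in> insert e S. (f(e := True)) x}) = (\<lambda>f. F (insert e {x \<in> S. f x}))"
    using assms(2) by (intro ext arg_cong[where f = F]) auto
  also have "(\<lambda>f. F {x \<in> insert e S. (f(e := False)) x}) = (\<lambda>f. F {x \<in> S. f x})"
    using assms(2) by (intro ext arg_cong[where f = F]) auto
  finally show ?thesis by (simp add: bexp_def)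
qed

lemma bexp_mono:
  assumes "finite S" "\<And>X. X \<subseteq> S \<Longrightarrow> F X \<le> G X"
  shows "bexp p S F \<le> bexp p S G"
proof -
  have "(\<forall>X\<subseteq>S. F X \<le> G X) \<longrightarrow> bexp p S F \<le> bexp p S G"
    using assms(1)
  proof (induction S arbitrary: F G rule: finite_induct)
    case empty
    show ?case by simp
  next
    case (insert e S)
    show ?case
    proof
      assume *: "\<forall>X\<subseteq>insert e S. F X \<le> G X"
      have "bexp p S (\<lambda>X. F (insert e X)) \<le> bexp p S (\<lambda>X. G (insert e X))"
        by (rule insert.IH[rule_format]) (use * in blast)
      moreover have "bexp p S F \<le> bexp p S G"
        by (rule insert.IH[rule_format]) (use * in blast)
      ultimately show "bexp p (insert e S) F \<le> bexp p (insert e S) G"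
        unfolding bexp_insert[OF insert.hyps] using p01 by (intro add_mono mult_left_mono) simp_all
    qed
  qed
  then show ?thesis using assms(2) by blast
qed

lemma bexp_cong:
  assumes "finite S" "\<And>X. X \<subseteq> S \<Longrightarrow> F X = G X"
  shows "bexp p S F = bexp p S G"
proof (rule antisym)
  show "bexp p S F \<le> bexp p S G" by (rule bexp_mono[OF assms(1)]) (simp only: assms(2))
  show "bexp p S G \<le> bexp p S F" by (rule bexp_mono[OF assms(1)]) (simp only: assms(2))
qed

lemma bexp_const [simp]: "finite S \<Longrightarrow> bexp p S (\<lambda>_. c) = c"
  by (induction S rule: finite_induct) (simp_all add: bexp_insert algebra_simps)

lemma bexp_add: "finite S \<Longrightarrow> bexp p S (\<lambda>X. F X + G X) = bexp p S F + bexp p S G"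
  by (induction S arbitrary: F G rule: finite_induct) (simp_all add: bexp_insert algebra_simps)

lemma bexp_cmult: "finite S \<Longrightarrow> bexp p S (\<lambda>X. c * F X) = c * bexp p S F"
  by (induction S arbitrary: F rule: finite_induct) (simp_all add: bexp_insert algebra_simps)

lemma bexp_diff: "finite S \<Longrightarrow> bexp p S (\<lambda>X. F X - G X) = bexp p S F - bexp p S G"
  using bexp_add[of S F "\<lambda>X. - 1 * G X"] bexp_cmult[of S "- 1" G] by simp

lemma bexp_sum:
  assumes "finite S"
  shows "bexp p S (\<lambda>X. \<Sum>i\<in>I. F i X) = (\<Sum>i\<in>I. bexp p S (F i))"
  using assms by (induction I rule: infinite_finite_induct) (simp_all add: bexp_add)

text \<open>Independence of the traces on disjoint sets; the random set can thus be exposed in two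
  rounds.\<close>

lemma bexp_Un:
  assumes "finite S" "finite T" "S \<inter> T = {}"
  shows "bexp p (S \<union> T) F = bexp p S (\<lambda>X. bexp p T (\<lambda>Y. F (X \<union> Y)))"
  using assms
  by (induction S arbitrary: F rule: finite_induct) (simp_all add: bexp_insert)

lemma bexp_swap:
  assumes "finite S" "finite T"
  shows "bexp p S (\<lambda>X. bexp p T (\<lambda>Y. F X Y)) = bexp p T (\<lambda>Y. bexp p S (\<lambda>X. F X Y))"
  using assms
  by (induction S arbitrary: F rule: finite_induct) (simp_all add: bexp_insert bexp_add bexp_cmult)

lemma bexp_restrict:
  assumes "finite S" "U \<subseteq> S"
  shows "bexp p S (\<lambda>X. F (X \<inter> U)) = bexp p U F"
proof -
  have f: "finite U" "finite (S - U)" using assms finite_subset by auto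
  have "bexp p (U \<union> (S - U)) (\<lambda>X. F (X \<inter> U)) = bexp p U (\<lambda>X. bexp p (S - U) (\<lambda>Y. F ((X \<union> Y) \<inter> U)))"
    using f by (intro bexp_Un) auto
  also have "\<dots> = bexp p U (\<lambda>X. bexp p (S - U) (\<lambda>Y. F X))"
  proof (intro bexp_cong f)
    fix X Y assume "X \<subseteq> U" "Y \<subseteq> S - U"
    then have "(X \<union> Y) \<inter> U = X" by blast
    then show "F ((X \<union> Y) \<inter> U) = F X" by simp
  qed
  finally show ?thesis using f assms(2) by (simp add: Un_absorb1)
qed

lemma bexp_image:
  assumes "finite U" "inj_on f U"
  shows "bexp p (f ` U) (\<lambda>X. F {u \<in> U. f u \<in> X}) = bexp p U F"
  using assms
proof (induction U arbitrary: F rule: finite_induct)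
  case (insert e U)
  have ne: "f e \<notin> f ` U" using insert by auto
  have *: "{u \<in> insert e U. f u \<in> insert (f e) X} = insert e {u \<in> U. f u \<in> X}" for X
    using insert.prems insert.hyps by (auto simp: inj_on_def)
  have **: "{u \<in> insert e U. f u \<in> X} = {u \<in> U. f u \<in> X}" if "X \<subseteq> f ` U" for X
    using ne that by auto
  have 1: "bexp p (f ` U) (\<lambda>X. F {u \<in> insert e U. f u \<in> insert (f e) X})
      = bexp p (f ` U) (\<lambda>X. F (insert e {u \<in> U. f u \<in> X}))"
    by (simp only: *)
  have 2: "bexp p (f ` U) (\<lambda>X. F {u \<in> insert e U. f u \<in> X})
      = bexp p (f ` U) (\<lambda>X. F {u \<in> U. f u \<in> X})"
    using insert.hyps by (intro bexp_cong) (simp_all only: finite_imageI **)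
  show ?case
    using insert 1 2 ne insert.IH[of "\<lambda>X. F (insert e X)"] insert.IH[of F]
    by (simp add: bexp_insert)
qed simp

text \<open>The trace on the image of \<open>f\<close> is all that matters, and injectivity makes
  its preimage a random subset of \<open>U\<close>. In this way bipartite graphs and neighbourhoods,
  indexed by vertices or pairs, are read off a single random edge set.\<close>

lemma bexp_vimage:
  assumes "finite S" "finite U" "inj_on f U" "f ` U \<subseteq> S"
  shows "bexp p S (\<lambda>X. F {u \<in> U. f u \<in> X}) = bexp p U F"
proof -
  have "bexp p S (\<lambda>X. F {u \<in> U. f u \<in> X}) = bexp p S (\<lambda>X. F {u \<in> U. f u \<in> X \<inter> f ` U})"
  proof (intro bexp_cong assms(1))
    fix X
    have "{u \<in> U. f u \<in> X} = {u \<in> U. f u \<in> X \<inter> f ` U}" by auto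
    then show "F {u \<in> U. f u \<in> X} = F {u \<in> U. f u \<in> X \<inter> f ` U}" by (rule arg_cong)
  qed
  also have "\<dots> = bexp p (f ` U) (\<lambda>X. F {u \<in> U. f u \<in> X})"
    using bexp_restrict[of S "f ` U" "\<lambda>X. F {u \<in> U. f u \<in> X}"] assms by simp
  also have "\<dots> = bexp p U F"
    using bexp_image assms(2,3) .
  finally show ?thesis .
qed

section \<open>Moments of the size of a random subset\<close>

lemma bexp_card: "finite S \<Longrightarrow> bexp p S (\<lambda>X. real (card X)) = p * card S"
proof (induction S rule: finite_induct)
  case (insert e S)
  have ins: "card (insert e X) = Suc (card X)" if "X \<subseteq> S" for X
    using insert.hyps that finite_subset[OF that] by (subst card_insert_disjoint) auto
  have "bexp p S (\<lambda>X. real (card (insert e X))) = bexp p S (\<lambda>X. 1 + real (card X))"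
    using insert by (intro bexp_cong) (simp_all add: ins)
  then show ?case using insert by (simp add: bexp_insert bexp_add algebra_simps)
qed simp

lemma bexp_variance:
  "finite S \<Longrightarrow> bexp p S (\<lambda>X. (real (card X) - p * card S)\<^sup>2) = p * (1 - p) * card S"
proof (induction S rule: finite_induct)
  case (insert e S)
  \<comment> \<open>The new element shifts the centred size by \<open>1 - p\<close> or by
    \<open>- p\<close>; after expanding the squares the cross terms are linear in \<open>D\<close>
    and have mean 0.\<close>
  define D where "D X = real (card X) - p * card S" for X :: "'a set"
  have ins: "card (insert e X) = Suc (card X)" if "X \<subseteq> S" for X
    using insert.hyps that finite_subset[OF that] by (subst card_insert_disjoint) auto
  have D: "bexp p S D = 0"
    using insert unfolding D_def by (simp add: bexp_diff bexp_card)
  have V: "bexp p S (\<lambda>X. (D X)\<^sup>2) = p * (1 - p) * card S"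
    using insert.IH by (simp add: D_def)
  have 1: "bexp p S (\<lambda>X. (real (card (insert e X)) - p * card (insert e S))\<^sup>2)
     = bexp p S (\<lambda>X. (D X)\<^sup>2 + (2 * (1 - p) * D X + (1 - p)\<^sup>2))"
    using insert.hyps ins by (intro bexp_cong) (simp_all add: D_def power2_eq_square algebra_simps)
  have 2: "bexp p S (\<lambda>X. (real (card X) - p * card (insert e S))\<^sup>2)
     = bexp p S (\<lambda>X. (D X)\<^sup>2 + ((- 2 * p) * D X + p\<^sup>2))"
    using insert.hyps by (intro bexp_cong) (simp_all add: D_def power2_eq_square algebra_simps)
  show ?case
    unfolding bexp_insert[OF insert.hyps] 1 2
    by (simp only: bexp_add[OF insert.hyps(1)] bexp_cmult[OF insert.hyps(1)] bexp_const[OF insert.hyps(1)] D V)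
       (simp add: insert.hyps power2_eq_square algebra_simps)
qed simp

text \<open>Leaving \<alpha> free keeps the bound linear in \<open>card S\<close>, so that it can be
  summed over vertices of different degrees with one common \<alpha>. A good value of \<alpha> is
  the standard deviation.\<close>

lemma bexp_abs_dev:
  assumes "finite S" "\<alpha> > 0"
  shows "bexp p S (\<lambda>X. \<bar>real (card X) - p * card S\<bar>) \<le> (\<alpha> + p * card S / \<alpha>) / 2"
proof -
  \<comment> \<open>AM-GM: \<open>2 \<bar>y\<bar> \<le> \<alpha> + y\<^sup>2 / \<alpha>\<close>\<close>
  have "bexp p S (\<lambda>X. \<bar>real (card X) - p * card S\<bar>)
      \<le> bexp p S (\<lambda>X. \<alpha> / 2 + (1 / (2 * \<alpha>)) * (real (card X) - p * card S)\<^sup>2)"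
  proof (rule bexp_mono[OF assms(1)])
    fix X :: "'a set"
    have "0 \<le> (\<bar>real (card X) - p * card S\<bar> - \<alpha>)\<^sup>2" by simp
    then show "\<bar>real (card X) - p * card S\<bar> \<le> \<alpha> / 2 + (1 / (2 * \<alpha>)) * (real (card X) - p * card S)\<^sup>2"
      using assms(2) by (simp add: power2_diff field_simps) (simp add: power2_eq_square)
  qed
  also have "\<dots> = \<alpha> / 2 + (1 / (2 * \<alpha>)) * (p * (1 - p) * card S)"
    using assms by (simp add: bexp_add bexp_cmult bexp_variance del: times_divide_eq_left)
  also have "\<dots> \<le> (\<alpha> + p * card S / \<alpha>) / 2"
  proof -
    have "p * (1 - p) * card S \<le> p * card S"
      using p01 by (intro mult_right_mono) (auto simp: mult_left_le)
    then show ?thesis using assms(2) by (simp add: field_simps)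
  qed
  finally show ?thesis .
qed

end

section \<open>Koenig's theorem\<close>

definition matching_in :: "('a \<times> 'b) set \<Rightarrow> ('a \<times> 'b) set \<Rightarrow> bool" where
  "matching_in E M \<longleftrightarrow> M \<subseteq> E \<and> inj_on fst M \<and> inj_on snd M"

definition vertex_cover :: "('a \<times> 'b) set \<Rightarrow> 'a set \<Rightarrow> 'b set \<Rightarrow> bool" where
  "vertex_cover E X Y \<longleftrightarrow> finite X \<and> finite Y \<and> (\<forall>(x, y)\<in>E. x \<in> X \<or> y \<in> Y)"

lemma vertex_cover_converse: "vertex_cover (E\<inverse>) Y X \<longleftrightarrow> vertex_cover E X Y"
  by (auto simp: vertex_cover_def)

text \<open>Lovasz's proof of Koenig's theorem: covers of the graphs obtained by deleting either edge combine to
  two covers of the whole graph, whose sizes add up to at most \<open>2 * k + 1\<close>; hence one of them has size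
  at most \<open>k\<close>.\<close>

lemma merge_covers:
  assumes c1: "vertex_cover (E - {(x, y)}) X1 Y1" and c2: "vertex_cover (E - {(x, z)}) X2 Y2"
    and "y \<noteq> z" and k: "card X1 + card Y1 \<le> k" "card X2 + card Y2 \<le> k"
    and n1: "x \<notin> X1" "y \<notin> Y1" and n2: "x \<notin> X2" "z \<notin> Y2"
    and e: "(x, y) \<in> E" "(x, z) \<in> E"
  shows "\<exists>X Y. vertex_cover E X Y \<and> card X + card Y \<le> k"
proof -
  have fin: "finite X1" "finite Y1" "finite X2" "finite Y2"
    using c1 c2 by (auto simp: vertex_cover_def)
  have y: "y \<in> Y2" and z: "z \<in> Y1"
    using c1 c2 e \<open>y \<noteq> z\<close> n1 n2 by (auto simp: vertex_cover_def)
  have A: "vertex_cover E (insert x (X1 \<union> X2)) (Y1 \<inter> Y2)"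
    using c1 c2 y z by (force simp: vertex_cover_def)
  have B: "vertex_cover E (X1 \<inter> X2) (Y1 \<union> Y2)"
    using c1 c2 y z by (force simp: vertex_cover_def)
  have "card (insert x (X1 \<union> X2)) + card (Y1 \<inter> Y2) + (card (X1 \<inter> X2) + card (Y1 \<union> Y2))
      = 1 + (card X1 + card X2) + (card Y1 + card Y2)"
    using fin n1 n2 by (simp add: card_Un_Int[of X1 X2] card_Un_Int[of Y1 Y2])
  also have "\<dots> \<le> 2 * k + 1" using k by simp
  finally have "card (insert x (X1 \<union> X2)) + card (Y1 \<inter> Y2) \<le> k \<or> card (X1 \<inter> X2) + card (Y1 \<union> Y2) \<le> k"
    by linarith
  then show ?thesis using A B by blast
qed

theorem koenig:
  assumes "finite E"
  shows "\<exists>M X Y. matching_in E M \<and> vertex_cover E X Y \<and> card X + card Y \<le> card M"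
  using assms
proof (induction E rule: finite_psubset_induct)
  case (psubset E)
  have mono: "matching_in E M" if "matching_in (E - D) M" for M D
    using that by (auto simp: matching_in_def)
  \<comment> \<open>Each graph with one edge deleted has a matching and a cover by induction. If
    neither cover works for \<open>E\<close>, the two are merged with the larger matching size as
    \<open>k\<close>; the larger matching is also a matching in \<open>E\<close>.\<close>
  have main: ?case if ef: "e \<in> E" "f \<in> E" "e \<noteq> f"
    and merge: "\<And>X1 Y1 X2 Y2 k. \<lbrakk>vertex_cover (E - {e}) X1 Y1; vertex_cover (E - {f}) X2 Y2;
       \<not> vertex_cover E X1 Y1; \<not> vertex_cover E X2 Y2; card X1 + card Y1 \<le> k; card X2 + card Y2 \<le> k\<rbrakk>
       \<Longrightarrow> \<exists>X Y. vertex_cover E X Y \<and> card X + card Y \<le> k" for e f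
  proof -
    obtain M1 X1 Y1 where 1: "matching_in (E - {e}) M1" "vertex_cover (E - {e}) X1 Y1" "card X1 + card Y1 \<le> card M1"
      using psubset.IH[of "E - {e}"] ef by blast
    obtain M2 X2 Y2 where 2: "matching_in (E - {f}) M2" "vertex_cover (E - {f}) X2 Y2" "card X2 + card Y2 \<le> card M2"
      using psubset.IH[of "E - {f}"] ef by blast
    show ?thesis
    proof (cases "vertex_cover E X1 Y1 \<or> vertex_cover E X2 Y2")
      case True then show ?thesis using 1 2 mono by blast
    next
      case False
      obtain X Y where XY: "vertex_cover E X Y" "card X + card Y \<le> max (card M1) (card M2)"
        using merge[of X1 Y1 X2 Y2 "max (card M1) (card M2)"] False 1 2 by (auto simp: le_max_iff_disj)
      show ?thesis
      proof (cases "card M1 \<le> card M2")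
        case True
        then show ?thesis using XY 2 mono[OF 2(1)] by (intro exI[of _ M2]) auto
      next
        case False
        then show ?thesis using XY 1 mono[OF 1(1)] by (intro exI[of _ M1]) auto
      qed
    qed
  qed
  show ?case
  proof (cases "matching_in E E")
    case True
    then have "card (fst ` E) = card E" by (simp add: matching_in_def card_image)
    with True show ?thesis
      using psubset.hyps by (intro exI[of _ E] exI[of _ "fst ` E"] exI[of _ "{}"]) (force simp: vertex_cover_def)
  next
    case False
    then consider (fst) x y z where "(x, y) \<in> E" "(x, z) \<in> E" "y \<noteq> z"
      | (snd) x y z where "(y, x) \<in> E" "(z, x) \<in> E" "y \<noteq> z"
      by (fastforce simp: matching_in_def inj_on_def)
    then show ?thesis
    proof cases
      case fst
      show ?thesis
      proof (rule main[of "(x, y)" "(x, z)"])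
        fix X1 Y1 X2 Y2 k
        assume a: "vertex_cover (E - {(x, y)}) X1 Y1" "vertex_cover (E - {(x, z)}) X2 Y2"
          "\<not> vertex_cover E X1 Y1" "\<not> vertex_cover E X2 Y2" "card X1 + card Y1 \<le> k" "card X2 + card Y2 \<le> k"
        then have "x \<notin> X1" "y \<notin> Y1" "x \<notin> X2" "z \<notin> Y2" by (auto simp: vertex_cover_def)
        then show "\<exists>X Y. vertex_cover E X Y \<and> card X + card Y \<le> k"
          using merge_covers[of E x y X1 Y1 z X2 Y2 k] a fst by blast
      qed (use fst in auto)
    next
      case snd
      show ?thesis
      proof (rule main[of "(y, x)" "(z, x)"])
        fix X1 Y1 X2 Y2 k
        assume a: "vertex_cover (E - {(y, x)}) X1 Y1" "vertex_cover (E - {(z, x)}) X2 Y2"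
          "\<not> vertex_cover E X1 Y1" "\<not> vertex_cover E X2 Y2" "card X1 + card Y1 \<le> k" "card X2 + card Y2 \<le> k"
        then have n: "x \<notin> Y1" "y \<notin> X1" "x \<notin> Y2" "z \<notin> X2" by (auto simp: vertex_cover_def)
        \<comment> \<open>Transposing the relation turns a common right endpoint into a common left
          one.\<close>
        have c: "vertex_cover (E\<inverse> - {(x, y)}) Y1 X1" "vertex_cover (E\<inverse> - {(x, z)}) Y2 X2"
          using a(1,2) by (auto simp: vertex_cover_def)
        show "\<exists>X Y. vertex_cover E X Y \<and> card X + card Y \<le> k"
          using merge_covers[OF c] n snd a(5,6) vertex_cover_converse[of E]
          by (metis add.commute converseI)
      qed (use snd in auto)
    qed
  qed
qed

text \<open>The cover of no larger size certifies that the matching is maximum. The choice depends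
  on \<open>E\<close> alone, so that everything built from it remains a function of the random edge
  set.\<close>

definition max_matching :: "('a \<times> 'b) set \<Rightarrow> ('a \<times> 'b) set" where
  "max_matching E = (SOME M. matching_in E M \<and> (\<exists>X Y. vertex_cover E X Y \<and> card X + card Y \<le> card M))"

lemma max_matching:
  assumes "finite E"
  shows "matching_in E (max_matching E)"
    and "\<exists>X Y. vertex_cover E X Y \<and> card X + card Y \<le> card (max_matching E)"
  using someI_ex[of "\<lambda>M. matching_in E M \<and> (\<exists>X Y. vertex_cover E X Y \<and> card X + card Y \<le> card M)"]
    koenig[OF assms] by (auto simp: max_matching_def)

text \<open>Every edge lies in the star of a vertex of the Koenig cover, and a star has at most
  \<open>D\<close> edges plus its excess over \<open>D\<close>. Thus \<open>D\<close> acts as a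
  maximum degree, with exceptional vertices charged individually.\<close>

lemma card_max_matching_ge:
  fixes D :: real
  assumes E: "E \<subseteq> B \<times> C" and fin: "finite B" "finite C" and D: "D \<ge> 0"
  shows "D * card (max_matching E) \<ge> card E - (\<Sum>b\<in>B. max 0 (card (E `` {b}) - D))
     - (\<Sum>c\<in>C. max 0 (card (E\<inverse> `` {c}) - D))"
proof -
  have finE: "finite E" using E fin by (meson finite_SigmaI finite_subset)
  obtain X Y where XY: "vertex_cover E X Y" "card X + card Y \<le> card (max_matching E)"
    using max_matching(2)[OF finE] by blast
  have "E \<subseteq> (\<Union>b\<in>X \<inter> B. {b} \<times> E `` {b}) \<union> (\<Union>c\<in>Y \<inter> C. (E\<inverse> `` {c}) \<times> {c})"
    using XY(1) E by (auto simp: vertex_cover_def)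
  then have "card E \<le> card ((\<Union>b\<in>X \<inter> B. {b} \<times> E `` {b}) \<union> (\<Union>c\<in>Y \<inter> C. (E\<inverse> `` {c}) \<times> {c}))"
    using finE fin by (intro card_mono) (auto intro!: finite_Image)
  also have "\<dots> \<le> card (\<Union>b\<in>X \<inter> B. {b} \<times> E `` {b}) + card (\<Union>c\<in>Y \<inter> C. (E\<inverse> `` {c}) \<times> {c})"
    by (rule card_Un_le)
  also have "\<dots> \<le> (\<Sum>b\<in>X \<inter> B. card ({b} \<times> E `` {b})) + (\<Sum>c\<in>Y \<inter> C. card ((E\<inverse> `` {c}) \<times> {c}))"
    using fin by (intro add_mono card_UN_le) auto
  finally have "real (card E) \<le> (\<Sum>b\<in>X \<inter> B. real (card (E `` {b}))) + (\<Sum>c\<in>Y \<inter> C. real (card (E\<inverse> `` {c})))"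
    by (simp add: card_cartesian_product flip: of_nat_sum of_nat_add)
  also have "\<dots> \<le> (\<Sum>b\<in>X \<inter> B. D + max 0 (card (E `` {b}) - D)) + (\<Sum>c\<in>Y \<inter> C. D + max 0 (card (E\<inverse> `` {c}) - D))"
    by (intro add_mono sum_mono) auto
  also have "\<dots> = D * (card (X \<inter> B) + card (Y \<inter> C))
      + (\<Sum>b\<in>X \<inter> B. max 0 (card (E `` {b}) - D)) + (\<Sum>c\<in>Y \<inter> C. max 0 (card (E\<inverse> `` {c}) - D))"
    by (simp add: sum.distrib algebra_simps)
  also have "\<dots> \<le> D * card (max_matching E)
      + (\<Sum>b\<in>B. max 0 (card (E `` {b}) - D)) + (\<Sum>c\<in>C. max 0 (card (E\<inverse> `` {c}) - D))"
  proof -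
    have "card (X \<inter> B) \<le> card X" "card (Y \<inter> C) \<le> card Y"
      using XY(1) by (auto intro!: card_mono simp: vertex_cover_def)
    then have "D * real (card (X \<inter> B) + card (Y \<inter> C)) \<le> D * card (max_matching E)"
      using XY(2) D by (intro mult_left_mono) linarith+
    moreover have "(\<Sum>b\<in>X \<inter> B. max 0 (card (E `` {b}) - D)) \<le> (\<Sum>b\<in>B. max 0 (card (E `` {b}) - D))"
      "(\<Sum>c\<in>Y \<inter> C. max 0 (card (E\<inverse> `` {c}) - D)) \<le> (\<Sum>c\<in>C. max 0 (card (E\<inverse> `` {c}) - D))"
      using fin by (auto intro!: sum_mono2)
    ultimately show ?thesis by linarith
  qed
  finally show ?thesis by linarith
qed

section \<open>Matchings in random induced subgraphs\<close>

context
  fixes p :: real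
  assumes p01: "0 \<le> p" "p \<le> 1"
begin

lemma bexp_sum_members:
  assumes "finite S"
  shows "bexp p S (\<lambda>X. \<Sum>x\<in>X. g x) = p * (\<Sum>x\<in>S. g x)"
  using assms
proof (induction S rule: finite_induct)
  case (insert e S)
  have "bexp p S (\<lambda>X. \<Sum>x\<in>insert e X. g x) = bexp p S (\<lambda>X. g e + (\<Sum>x\<in>X. g x))"
  proof (rule bexp_cong[OF p01 insert.hyps(1)])
    fix X assume "X \<subseteq> S"
    then have "finite X" "e \<notin> X" using insert.hyps finite_subset by auto
    then show "(\<Sum>x\<in>insert e X. g x) = g e + (\<Sum>x\<in>X. g x)" by simp
  qed
  then show ?case
    using insert.hyps insert.IH by (simp add: bexp_insert[OF p01] bexp_add[OF p01] bexp_const[OF p01] algebra_simps)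
qed (simp add: bexp_empty[OF p01])

lemma bexp_independent:
  assumes "finite S" "finite U" "inj_on f U" "f ` U \<subseteq> S"
    and K: "\<And>G X. G \<subseteq> S \<Longrightarrow> K (G - f ` U) X = K G X"
  shows "bexp p S (\<lambda>G. K G {u \<in> U. f u \<in> G}) = bexp p S (\<lambda>G. bexp p U (\<lambda>X. K G X))"
proof -
  let ?T = "S - f ` U"
  have fin: "finite ?T" "finite (f ` U)" and S: "S = ?T \<union> f ` U" using assms by auto
  have eq: "(G \<union> H) - f ` U = G" if "G \<subseteq> ?T" "H \<subseteq> f ` U" for G H using that by blast
  have eq2: "K (G \<union> H) = K G" if "G \<subseteq> ?T" "H \<subseteq> f ` U" for G H
    using K[of "G \<union> H"] eq[OF that] that S by (intro ext) fastforce
  have eq3: "{u \<in> U. f u \<in> G \<union> H} = {u \<in> U. f u \<in> H}" if "G \<subseteq> ?T" for G H using that by blast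
  have split: "bexp p S F = bexp p ?T (\<lambda>G. bexp p (f ` U) (\<lambda>H. F (G \<union> H)))" for F
    using bexp_Un[OF p01 fin, of F] S by (simp add: Int_commute)
  have "bexp p S (\<lambda>G. K G {u \<in> U. f u \<in> G})
      = bexp p ?T (\<lambda>G. bexp p (f ` U) (\<lambda>H. K G {u \<in> U. f u \<in> H}))"
    unfolding split by (rule bexp_cong[OF p01 fin(1)], rule bexp_cong[OF p01 fin(2)]) (simp only: eq2 eq3)
  also have "\<dots> = bexp p ?T (\<lambda>G. bexp p U (\<lambda>X. K G X))"
    by (simp only: bexp_image[OF p01 assms(2,3)])
  also have "\<dots> = bexp p ?T (\<lambda>G. bexp p (f ` U) (\<lambda>H. bexp p U (\<lambda>X. K G X)))"
    by (simp only: bexp_const[OF p01 fin(2)])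
  also have "\<dots> = bexp p S (\<lambda>G. bexp p U (\<lambda>X. K G X))"
    unfolding split by (rule bexp_cong[OF p01 fin(1)], rule bexp_cong[OF p01 fin(2)]) (simp only: eq2)
  finally show ?thesis .
qed

text \<open>The positive part is 1-Lipschitz, so passing to a random subset raises the excess of the
  mean by at most the absolute deviation.\<close>

lemma bexp_excess:
  assumes "finite C" "U \<subseteq> C" "\<alpha> > 0"
  shows "bexp p C (\<lambda>Y. max 0 (real (card (U \<inter> Y)) - D))
     \<le> max 0 (p * card U - D) + (\<alpha> + p * card U / \<alpha>) / 2"
proof -
  have fU: "finite U" using assms finite_subset by auto
  have "bexp p C (\<lambda>Y. max 0 (real (card (U \<inter> Y)) - D)) = bexp p U (\<lambda>Y. max 0 (real (card Y) - D))"
    using bexp_restrict[OF p01 assms(1,2), of "\<lambda>Y. max 0 (real (card Y) - D)"] by (simp add: Int_commute)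
  also have "\<dots> \<le> bexp p U (\<lambda>Y. max 0 (p * card U - D) + \<bar>real (card Y) - p * card U\<bar>)"
    by (rule bexp_mono[OF p01 fU]) linarith
  also have "\<dots> = max 0 (p * card U - D) + bexp p U (\<lambda>Y. \<bar>real (card Y) - p * card U\<bar>)"
    using fU by (simp add: bexp_add[OF p01] bexp_const[OF p01])
  finally show ?thesis using bexp_abs_dev[OF p01 fU assms(3)] by linarith
qed

text \<open>Averages \<open>card_max_matching_ge\<close> over the random subgraph. An edge survives
  with probability \<open>p\<^sup>2\<close>. A vertex survives with probability \<open>p\<close>,
  independently of its surviving neighbours on the other side, hence the factor \<open>p\<close>
  before each sum of excesses.\<close>

lemma bexp_max_matching_ge:
  fixes L :: "('a \<times> 'b) set"
  assumes L: "L \<subseteq> B \<times> C" and fin: "finite B" "finite C" and D: "D \<ge> 0" and \<alpha>: "\<alpha> > 0"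
  shows "D * bexp p B (\<lambda>X. bexp p C (\<lambda>Y. card (max_matching (L \<inter> X \<times> Y))))
    \<ge> p\<^sup>2 * card L
      - p * (\<Sum>b\<in>B. max 0 (p * card (L `` {b}) - D) + (\<alpha> + p * card (L `` {b}) / \<alpha>) / 2)
      - p * (\<Sum>c\<in>C. max 0 (p * card (L\<inverse> `` {c}) - D) + (\<alpha> + p * card (L\<inverse> `` {c}) / \<alpha>) / 2)"
proof -
  have finL: "finite L" using L fin by (meson finite_SigmaI finite_subset)
  have LB: "L `` {b} \<subseteq> C" "L\<inverse> `` {c} \<subseteq> B" for b c using L by auto
  define e where "e X Y = (\<Sum>b\<in>X. real (card (L `` {b} \<inter> Y)))" for X Y
  define eB where "eB X Y = (\<Sum>b\<in>X. max 0 (real (card (L `` {b} \<inter> Y)) - D))" for X Y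
  define eC where "eC X Y = (\<Sum>c\<in>Y. max 0 (real (card (L\<inverse> `` {c} \<inter> X)) - D))" for X Y
  have card_L: "real (card L) = (\<Sum>b\<in>B. real (card (L `` {b})))"
  proof -
    have "L = Sigma B (\<lambda>b. L `` {b})" using L by auto
    then have "card L = (\<Sum>b\<in>B. card (L `` {b}))"
      using card_SigmaI[of B "\<lambda>b. L `` {b}"] fin finL by (metis finite_Image)
    then show ?thesis by simp
  qed
  have pointwise: "D * card (max_matching (L \<inter> X \<times> Y)) \<ge> e X Y - eB X Y - eC X Y"
    if XY: "X \<subseteq> B" "Y \<subseteq> C" for X Y
  proof -
    have fXY: "finite X" "finite Y" using XY fin finite_subset by auto
    have i: "(L \<inter> X \<times> Y) `` {b} = L `` {b} \<inter> Y" if "b \<in> X" for b using that by auto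
    have j: "(L \<inter> X \<times> Y)\<inverse> `` {c} = L\<inverse> `` {c} \<inter> X" if "c \<in> Y" for c using that by auto
    have "L \<inter> X \<times> Y = Sigma X (\<lambda>b. L `` {b} \<inter> Y)" by auto
    then have "card (L \<inter> X \<times> Y) = (\<Sum>b\<in>X. card (L `` {b} \<inter> Y))"
      using card_SigmaI[of X "\<lambda>b. L `` {b} \<inter> Y"] fXY by simp
    then have "real (card (L \<inter> X \<times> Y)) = e X Y" by (simp add: e_def)
    moreover have "eB X Y = (\<Sum>b\<in>X. max 0 (card ((L \<inter> X \<times> Y) `` {b}) - D))"
      unfolding eB_def by (rule sum.cong) (simp_all add: i)
    moreover have "eC X Y = (\<Sum>c\<in>Y. max 0 (card ((L \<inter> X \<times> Y)\<inverse> `` {c}) - D))"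
      unfolding eC_def by (rule sum.cong[OF refl]) (simp only: j)
    ultimately show ?thesis
      using card_max_matching_ge[of "L \<inter> X \<times> Y" X Y D] fXY D by simp
  qed
  have "bexp p B (\<lambda>X. bexp p C (\<lambda>Y. e X Y - eB X Y - eC X Y))
      \<le> bexp p B (\<lambda>X. bexp p C (\<lambda>Y. D * card (max_matching (L \<inter> X \<times> Y))))"
    by (intro bexp_mono[OF p01] fin pointwise)
  also have "\<dots> = D * bexp p B (\<lambda>X. bexp p C (\<lambda>Y. card (max_matching (L \<inter> X \<times> Y))))"
    by (simp only: bexp_cmult[OF p01 fin(1)] bexp_cmult[OF p01 fin(2)])
  finally have "D * bexp p B (\<lambda>X. bexp p C (\<lambda>Y. card (max_matching (L \<inter> X \<times> Y))))
     \<ge> bexp p B (\<lambda>X. bexp p C (e X)) - bexp p B (\<lambda>X. bexp p C (eB X)) - bexp p B (\<lambda>X. bexp p C (eC X))"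
    by (simp only: bexp_diff[OF p01 fin(1)] bexp_diff[OF p01 fin(2)])
  moreover have "bexp p B (\<lambda>X. bexp p C (e X)) = p\<^sup>2 * card L"
  proof -
    have "bexp p C (\<lambda>Y. real (card (L `` {b} \<inter> Y))) = p * card (L `` {b})" for b
      using bexp_restrict[OF p01 fin(2) LB(1)[of b], of "\<lambda>Y. real (card Y)"]
        bexp_card[OF p01 finite_subset[OF LB(1) fin(2)], of b] by (simp add: Int_commute)
    then have "bexp p B (\<lambda>X. bexp p C (e X)) = p * (\<Sum>b\<in>B. p * card (L `` {b}))"
      unfolding e_def by (simp only: bexp_sum[OF p01 fin(2)] bexp_sum_members[OF fin(1)])
    then show ?thesis by (simp add: card_L power2_eq_square sum_distrib_left mult.assoc)
  qed
  moreover have "bexp p B (\<lambda>X. bexp p C (eB X))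
      \<le> p * (\<Sum>b\<in>B. max 0 (p * card (L `` {b}) - D) + (\<alpha> + p * card (L `` {b}) / \<alpha>) / 2)"
    unfolding eB_def bexp_sum[OF p01 fin(2)] bexp_sum_members[OF fin(1)]
    by (intro mult_left_mono sum_mono bexp_excess fin LB \<alpha> p01)
  moreover have "bexp p B (\<lambda>X. bexp p C (eC X))
      \<le> p * (\<Sum>c\<in>C. max 0 (p * card (L\<inverse> `` {c}) - D) + (\<alpha> + p * card (L\<inverse> `` {c}) / \<alpha>) / 2)"
    unfolding bexp_swap[OF p01 fin] eC_def bexp_sum[OF p01 fin(1)] bexp_sum_members[OF fin(2)]
    by (intro mult_left_mono sum_mono bexp_excess fin LB \<alpha> p01)
  ultimately show ?thesis by linarith
qed

text \<open>Here \<open>d0\<close> stands for the initial degree of \<open>j\<close>,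
  \<open>dt\<close> for the degree after \<open>t\<close> steps and \<open>dA\<close> for the number
  of neighbours among the processed vertices. The reason is the identity
  \<open>dt - (x - y) = (d0 - x) - (dA - y) + (dA - (d0 - dt))\<close>, whose last bracket counts
  the neighbours that removed no edge at \<open>j\<close> and is nonnegative by assumption.\<close>

lemma bexp_sum_excess:
  fixes d0 dA dt :: "'j \<Rightarrow> 'a set \<Rightarrow> real" and s :: real
  assumes fin: "finite E" "finite J"
    and d: "\<And>j G. j \<in> J \<Longrightarrow> G \<subseteq> E \<Longrightarrow> d0 j G - dt j G \<le> dA j G"
    and d0: "\<And>j. j \<in> J \<Longrightarrow> bexp p E (\<lambda>G. \<bar>d0 j G - x\<bar>) \<le> s"
    and dA: "\<And>j. j \<in> J \<Longrightarrow> bexp p E (\<lambda>G. \<bar>dA j G - y\<bar>) \<le> s"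
  shows "bexp p E (\<lambda>G. \<Sum>j\<in>J. max 0 (dt j G - (x - y)))
     \<le> 2 * card J * s + bexp p E (\<lambda>G. \<Sum>j\<in>J. dA j G - (d0 j G - dt j G))"
proof -
  have "bexp p E (\<lambda>G. \<Sum>j\<in>J. max 0 (dt j G - (x - y)))
     \<le> bexp p E (\<lambda>G. \<Sum>j\<in>J. \<bar>d0 j G - x\<bar> + \<bar>dA j G - y\<bar> + (dA j G - (d0 j G - dt j G)))"
  proof (intro bexp_mono[OF p01 fin(1)] sum_mono)
    fix G j assume "G \<subseteq> E" "j \<in> J"
    then show "max 0 (dt j G - (x - y)) \<le> \<bar>d0 j G - x\<bar> + \<bar>dA j G - y\<bar> + (dA j G - (d0 j G - dt j G))"
      using d[of j G] by linarith
  qed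
  also have "\<dots> = (\<Sum>j\<in>J. bexp p E (\<lambda>G. \<bar>d0 j G - x\<bar>) + bexp p E (\<lambda>G. \<bar>dA j G - y\<bar>))
      + bexp p E (\<lambda>G. \<Sum>j\<in>J. dA j G - (d0 j G - dt j G))"
    by (simp only: bexp_sum[OF p01 fin(1)] bexp_add[OF p01 fin(1)] sum.distrib)
  also have "(\<Sum>j\<in>J. bexp p E (\<lambda>G. \<bar>d0 j G - x\<bar>) + bexp p E (\<lambda>G. \<bar>dA j G - y\<bar>)) \<le> (\<Sum>j\<in>J. s + s)"
    using d0 dA by (intro sum_mono add_mono) auto
  finally show ?thesis by simp
qed

end

section \<open>Triangles in a random tripartite graph\<close>

lemma vertex_pairs_triple:
  assumes "x \<noteq> y" "x \<noteq> z" "y \<noteq> z"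
  shows "vertex_pairs {x, y, z} = {{x, y}, {x, z}, {y, z}}"
  using assms by (auto simp: vertex_pairs_def card_2_iff doubleton_eq_iff)

lemma card_Image_le_1:
  assumes "finite M" "inj_on fst M"
  shows "card (M `` {x}) \<le> 1"
proof -
  have "finite (M `` {x})" using assms(1) by simp
  moreover have "y = z" if "y \<in> M `` {x}" "z \<in> M `` {x}" for y z
    using that assms(2) by (auto dest: inj_onD[of _ _ "(x, y)" "(x, z)"])
  ultimately show ?thesis unfolding One_nat_def by (subst card_le_Suc0_iff_eq) blast+
qed

lemma inj_on_edge: "x \<notin> U \<Longrightarrow> inj_on (\<lambda>y. {x, y}) U"
  by (auto simp: inj_on_def doubleton_eq_iff)

text \<open>The enumeration \<open>a\<close> of the class A fixes the order of processing.
  \<open>E\<close> need only contain the edges between the parts, so that all triples of classes can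
  be treated inside the same random graph.\<close>

locale triangle_process =
  fixes p :: real and q :: nat and E :: "'v set set" and a :: "nat \<Rightarrow> 'v" and B C :: "'v set"
  assumes p: "0 < p" "p \<le> 1"
    and card_parts: "card B = q" "card C = q" "0 < q"
    and finite_E: "finite E"
    and inj_a: "inj_on a {..<q}"
    and disjoint: "a ` {..<q} \<inter> (B \<union> C) = {}" "B \<inter> C = {}"
    and edges: "\<And>i x. i < q \<Longrightarrow> x \<in> B \<union> C \<Longrightarrow> {a i, x} \<in> E" "\<And>b c. b \<in> B \<Longrightarrow> c \<in> C \<Longrightarrow> {b, c} \<in> E"
begin

lemma p01: "0 \<le> p" "p \<le> 1"
  using p by auto

lemma finite_parts [simp]: "finite B" "finite C"
  using card_parts card.infinite by fastforce+

definition nbrs :: "'v set \<Rightarrow> 'v set set \<Rightarrow> nat \<Rightarrow> 'v set" where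
  "nbrs U G i = {x \<in> U. {a i, x} \<in> G}"

definition base :: "'v set set \<Rightarrow> ('v \<times> 'v) set" where
  "base G = {e \<in> B \<times> C. {fst e, snd e} \<in> G}"

primrec leftover :: "'v set set \<Rightarrow> nat \<Rightarrow> ('v \<times> 'v) set" where
  "leftover G 0 = base G"
| "leftover G (Suc t) = leftover G t - max_matching (leftover G t \<inter> nbrs B G t \<times> nbrs C G t)"

definition link_matching :: "'v set set \<Rightarrow> nat \<Rightarrow> ('v \<times> 'v) set" where
  "link_matching G t = max_matching (leftover G t \<inter> nbrs B G t \<times> nbrs C G t)"

lemma leftover_Suc: "leftover G (Suc t) = leftover G t - link_matching G t"
  by (simp add: link_matching_def)

declare leftover.simps(2) [simp del]

lemma base_subset: "base G \<subseteq> B \<times> C"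
  by (auto simp: base_def)

lemma leftover_subset: "leftover G t \<subseteq> base G"
  by (induction t) (auto simp: leftover_Suc)

lemma finite_leftover [simp]: "finite (base G)" "finite (leftover G t)"
  using base_subset leftover_subset finite_parts by (metis finite_SigmaI finite_subset)+

lemma link_matching:
  "link_matching G t \<subseteq> leftover G t \<inter> nbrs B G t \<times> nbrs C G t"
  "inj_on fst (link_matching G t)" "inj_on snd (link_matching G t)"
  using max_matching(1)[of "leftover G t \<inter> nbrs B G t \<times> nbrs C G t"]
  by (auto simp: link_matching_def matching_in_def)

lemma finite_link_matching [simp]: "finite (link_matching G t)"
  using link_matching(1) finite_leftover finite_subset by (metis le_inf_iff)

lemma card_leftover_Suc: "card (leftover G (Suc t)) + card (link_matching G t) = card (leftover G t)"
proof -
  have "link_matching G t \<subseteq> leftover G t" using link_matching(1) by blast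
  then show ?thesis
    unfolding leftover_Suc using card_mono[of "leftover G t" "link_matching G t"]
    by (simp add: card_Diff_subset)
qed

lemma leftover_cong:
  assumes "base G = base G'" "\<And>i. i < t \<Longrightarrow> nbrs B G i = nbrs B G' i" "\<And>i. i < t \<Longrightarrow> nbrs C G i = nbrs C G' i"
  shows "leftover G t = leftover G' t"
  using assms(2,3) by (induction t) (simp_all add: assms(1) leftover.simps(2))

text \<open>Edges at \<open>a t\<close> between A and the other classes are not inspected before
  step \<open>t\<close>. This is the independence that allows the neighbourhoods of
  \<open>a t\<close> to be resampled.\<close>

lemma leftover_Diff_star:
  assumes "t < q" "U \<subseteq> B \<union> C"
  shows "leftover (G - (\<lambda>x. {a t, x}) ` U) t = leftover G t"
proof (rule leftover_cong)
  have at: "a t \<notin> B \<union> C" using disjoint assms(1) by auto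
  show "base (G - (\<lambda>x. {a t, x}) ` U) = base G"
    unfolding base_def using at assms(2) by (auto simp: doubleton_eq_iff)
  fix i assume i: "i < t"
  then have ai: "a i \<noteq> a t" using inj_a assms(1) by (auto dest: inj_onD)
  have "{a i, x} \<notin> (\<lambda>x. {a t, x}) ` U" if "x \<in> B \<union> C" for x
    using ai at that by (auto simp: doubleton_eq_iff)
  then show "nbrs B (G - (\<lambda>x. {a t, x}) ` U) i = nbrs B G i"
    "nbrs C (G - (\<lambda>x. {a t, x}) ` U) i = nbrs C G i"
    unfolding nbrs_def by auto
qed

section \<open>Degrees in the leftover graph\<close>

lemma card_star_Suc:
  "card {i \<in> {..<Suc t}. {a i, x} \<in> G} = card {i \<in> {..<t}. {a i, x} \<in> G} + (if {a t, x} \<in> G then 1 else 0)"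
proof -
  have "{i \<in> {..<Suc t}. {a i, x} \<in> G} = (if {a t, x} \<in> G then insert t else id) {i \<in> {..<t}. {a i, x} \<in> G}"
    by (auto simp: less_Suc_eq)
  then show ?thesis by simp
qed

text \<open>A step removes at most one edge at \<open>b\<close>, being a matching, and none if its
  vertex is not adjacent to \<open>b\<close>. So the number of wasted neighbours of \<open>b\<close>
  is nonnegative, as \<open>bexp_sum_excess\<close> demands.\<close>

lemma card_base_Image_le:
  "card (base G `` {b}) \<le> card (leftover G t `` {b}) + card {i \<in> {..<t}. {a i, b} \<in> G}"
proof (induction t)
  case (Suc t)
  have "link_matching G t `` {b} = {}" if "{a t, b} \<notin> G"
    using that link_matching(1)[of G t] by (auto simp: nbrs_def)
  then have "card (link_matching G t `` {b}) \<le> (if {a t, b} \<in> G then 1 else 0)"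
    using card_Image_le_1[OF finite_link_matching link_matching(2)] by auto
  moreover have "card (leftover G t `` {b}) \<le> card (leftover G (Suc t) `` {b}) + card (link_matching G t `` {b})"
    by (rule order_trans[OF card_mono card_Un_le]) (auto simp: leftover_Suc)
  ultimately show ?case using Suc card_star_Suc[where x = b and G = G and t = t] by linarith
qed simp

lemma card_base_converse_Image_le:
  "card ((base G)\<inverse> `` {c}) \<le> card ((leftover G t)\<inverse> `` {c}) + card {i \<in> {..<t}. {a i, c} \<in> G}"
proof (induction t)
  case (Suc t)
  have "(link_matching G t)\<inverse> `` {c} = {}" if "{a t, c} \<notin> G"
    using that link_matching(1)[of G t] by (auto simp: nbrs_def)
  moreover have "inj_on fst ((link_matching G t)\<inverse>)"
    using link_matching(3)[of G t] unfolding inj_on_def by fastforce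
  ultimately have "card ((link_matching G t)\<inverse> `` {c}) \<le> (if {a t, c} \<in> G then 1 else 0)"
    using card_Image_le_1[of "(link_matching G t)\<inverse>"] by auto
  moreover have "card ((leftover G t)\<inverse> `` {c})
      \<le> card ((leftover G (Suc t))\<inverse> `` {c}) + card ((link_matching G t)\<inverse> `` {c})"
    by (rule order_trans[OF card_mono card_Un_le]) (auto simp: leftover_Suc)
  ultimately show ?case using Suc card_star_Suc[where x = c and G = G and t = t] by linarith
qed simp

lemma card_eq_sum_Image:
  fixes L :: "('v \<times> 'v) set"
  assumes "L \<subseteq> B \<times> C"
  shows "card L = (\<Sum>b\<in>B. card (L `` {b}))" "card L = (\<Sum>c\<in>C. card (L\<inverse> `` {c}))"
proof -
  have fin: "finite L" using assms finite_parts by (meson finite_SigmaI finite_subset)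
  have "L = Sigma B (\<lambda>b. L `` {b})" "L\<inverse> = Sigma C (\<lambda>c. L\<inverse> `` {c})" using assms by auto
  then show "card L = (\<Sum>b\<in>B. card (L `` {b}))" "card L = (\<Sum>c\<in>C. card (L\<inverse> `` {c}))"
    using card_SigmaI[of B "\<lambda>b. L `` {b}"] card_SigmaI[of C "\<lambda>c. L\<inverse> `` {c}"] fin
    by (metis finite_parts finite_Image finite_converse card_inverse)+
qed

section \<open>Means and deviations of the initial degrees\<close>

lemma inj_on_base: "inj_on (\<lambda>e. {fst e, snd e}) (B \<times> C)"
  using disjoint(2) by (auto simp: inj_on_def doubleton_eq_iff)

lemma bexp_card_base: "bexp p E (\<lambda>G. real (card (base G))) = p * q\<^sup>2"
proof -
  have "bexp p E (\<lambda>G. real (card (base G))) = bexp p (B \<times> C) (\<lambda>X. real (card X))"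
    unfolding base_def
    by (rule bexp_vimage[OF p01, of E "B \<times> C" "\<lambda>e. {fst e, snd e}" "\<lambda>X. real (card X)"])
       (use finite_E inj_on_base edges(2) in auto)
  then show ?thesis
    by (simp add: bexp_card[OF p01] card_cartesian_product card_parts power2_eq_square)
qed

lemma abs_dev_vimage:
  assumes "finite U" "inj_on f U" "f ` U \<subseteq> E" "card U \<le> q"
  shows "bexp p E (\<lambda>G. \<bar>real (card {u \<in> U. f u \<in> G}) - p * card U\<bar>) \<le> sqrt q"
proof -
  have "bexp p E (\<lambda>G. \<bar>real (card {u \<in> U. f u \<in> G}) - p * card U\<bar>)
     = bexp p U (\<lambda>X. \<bar>real (card X) - p * card U\<bar>)"
    by (rule bexp_vimage[OF p01 finite_E assms(1-3), of "\<lambda>X. \<bar>real (card X) - p * card U\<bar>"])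
  \<comment> \<open>The scale \<open>sqrt q\<close> ignores a factor \<open>sqrt p\<close>. This is
    harmless: in \<open>shortfall_Suc\<close> these deviations carry a factor
    \<open>p\<^sup>2\<close> and so have the order \<open>p\<^sup>2 * q * sqrt q\<close> of the
    deviations inside the link.\<close>
  also have "\<dots> \<le> (sqrt q + p * card U / sqrt q) / 2"
    by (rule bexp_abs_dev[OF p01 assms(1)]) (use card_parts in simp)
  also have "\<dots> \<le> (sqrt q + q / sqrt q) / 2"
    using p assms(4) mult_mono[of p 1 "card U" "real q"] by (intro divide_right_mono add_mono) auto
  also have "\<dots> = sqrt q"
    by (simp add: real_div_sqrt)
  finally show ?thesis .
qed

lemma inj_on_star:
  assumes "t \<le> q" "x \<in> B \<union> C"
  shows "inj_on (\<lambda>i. {a i, x}) {..<t}"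
proof (rule inj_onI)
  fix i j assume "i \<in> {..<t}" "j \<in> {..<t}" "{a i, x} = {a j, x}"
  moreover have "a i \<noteq> x" if "i < t" for i
  proof -
    have "a i \<in> a ` {..<q}" using that assms(1) by auto
    then show ?thesis using disjoint(1) assms(2) by blast
  qed
  ultimately show "i = j"
    using inj_a assms(1) by (auto simp: doubleton_eq_iff dest: inj_onD)
qed

lemma star_subset:
  assumes "t \<le> q" "x \<in> B \<union> C"
  shows "(\<lambda>i. {a i, x}) ` {..<t} \<subseteq> E"
  using edges(1)[OF _ assms(2)] assms(1) by (intro image_subsetI) simp

lemma abs_dev_star:
  assumes "t \<le> q" "x \<in> B \<union> C"
  shows "bexp p E (\<lambda>G. \<bar>real (card {i \<in> {..<t}. {a i, x} \<in> G}) - p * t\<bar>) \<le> sqrt q"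
  using abs_dev_vimage[OF _ inj_on_star[OF assms] star_subset[OF assms]] assms(1) by simp

lemma bexp_card_star:
  assumes "t \<le> q" "x \<in> B \<union> C"
  shows "bexp p E (\<lambda>G. real (card {i \<in> {..<t}. {a i, x} \<in> G})) = p * t"
  using bexp_vimage[OF p01 finite_E _ inj_on_star[OF assms] star_subset[OF assms], of "\<lambda>X. real (card X)"]
  by (simp add: bexp_card[OF p01])

text \<open>Ideally the first \<open>t\<close> vertices of \<open>A\<close> use up all their \<open>p * q * t\<close> expected edges to \<open>B\<close>.\<close>

definition shortfall :: "nat \<Rightarrow> real" where
  "shortfall t = p * q * t - bexp p E (\<lambda>G. real (card (base G)) - real (card (leftover G t)))"

lemma shortfall_0: "shortfall 0 = 0"
  by (simp add: shortfall_def bexp_const[OF p01 finite_E])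

text \<open>With base degrees for \<open>d0\<close> and leftover degrees for \<open>dt\<close>, the
  right-hand side is the shortfall: the wasted neighbours sum to it on either side, since a removed
  edge has one end in \<open>B\<close> and one in \<open>C\<close>.\<close>

lemma bexp_star_excess:
  assumes J: "J = B \<or> J = C" and t: "t \<le> q"
  shows "bexp p E (\<lambda>G. \<Sum>j\<in>J. real (card {i \<in> {..<t}. {a i, j} \<in> G}) - (d0 j G - dt j G))
     = p * q * t - bexp p E (\<lambda>G. (\<Sum>j\<in>J. d0 j G) - (\<Sum>j\<in>J. dt j G))"
proof -
  have "bexp p E (\<lambda>G. \<Sum>j\<in>J. real (card {i \<in> {..<t}. {a i, j} \<in> G}) - (d0 j G - dt j G))
     = (\<Sum>j\<in>J. bexp p E (\<lambda>G. real (card {i \<in> {..<t}. {a i, j} \<in> G})))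
       - bexp p E (\<lambda>G. (\<Sum>j\<in>J. d0 j G) - (\<Sum>j\<in>J. dt j G))"
    by (simp only: sum_subtractf bexp_diff[OF p01 finite_E] bexp_sum[OF p01 finite_E])
  also have "(\<Sum>j\<in>J. bexp p E (\<lambda>G. real (card {i \<in> {..<t}. {a i, j} \<in> G}))) = (\<Sum>j\<in>J. p * t)"
    by (rule sum.cong[OF refl], rule bexp_card_star) (use J t in auto)
  finally show ?thesis using J card_parts by auto
qed

text \<open>\<open>bexp_sum_excess\<close> with the means \<open>p * q\<close> in the base graph and
  \<open>p * t\<close> towards the processed vertices; each of the \<open>q\<close> vertices
  contributes two deviations of at most \<open>sqrt q\<close>.\<close>

lemma bexp_excess_leftover:
  assumes t: "t \<le> q"
  shows "bexp p E (\<lambda>G. \<Sum>b\<in>B. max 0 (real (card (leftover G t `` {b})) - (p * q - p * t))) \<le> 2 * q * sqrt q + shortfall t"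
    and "bexp p E (\<lambda>G. \<Sum>c\<in>C. max 0 (real (card ((leftover G t)\<inverse> `` {c})) - (p * q - p * t))) \<le> 2 * q * sqrt q + shortfall t"
proof -
  have sub: "leftover G t \<subseteq> B \<times> C" "base G \<subseteq> B \<times> C" for G
    using leftover_subset base_subset by (meson order_trans)+
  have "bexp p E (\<lambda>G. \<bar>real (card (base G `` {b})) - p * q\<bar>) \<le> sqrt q" if b: "b \<in> B" for b
  proof -
    have "base G `` {b} = {c \<in> C. {b, c} \<in> G}" for G using b by (auto simp: base_def)
    moreover have "b \<notin> C" using b disjoint by auto
    ultimately show ?thesis
      using abs_dev_vimage[of C "\<lambda>c. {b, c}"] inj_on_edge[of b C] edges(2) b card_parts by auto
  qed
  then have "bexp p E (\<lambda>G. \<Sum>b\<in>B. max 0 (real (card (leftover G t `` {b})) - (p * q - p * t)))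
    \<le> 2 * card B * sqrt q + bexp p E (\<lambda>G. \<Sum>b\<in>B. real (card {i \<in> {..<t}. {a i, b} \<in> G})
        - (real (card (base G `` {b})) - real (card (leftover G t `` {b}))))"
    by (intro bexp_sum_excess[OF p01 finite_E] abs_dev_star t)
      (use card_base_Image_le in \<open>auto simp: algebra_simps simp flip: of_nat_add\<close>)
  then show "bexp p E (\<lambda>G. \<Sum>b\<in>B. max 0 (real (card (leftover G t `` {b})) - (p * q - p * t))) \<le> 2 * q * sqrt q + shortfall t"
    unfolding bexp_star_excess[OF disjI1[OF refl] t] shortfall_def card_parts
      card_eq_sum_Image(1)[OF sub(1)] card_eq_sum_Image(1)[OF sub(2)] of_nat_sum .
  have "bexp p E (\<lambda>G. \<bar>real (card ((base G)\<inverse> `` {c})) - p * q\<bar>) \<le> sqrt q" if c: "c \<in> C" for c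
  proof -
    have "(base G)\<inverse> `` {c} = {b \<in> B. {c, b} \<in> G}" for G using c by (auto simp: base_def insert_commute)
    moreover have "c \<notin> B" using c disjoint by auto
    ultimately show ?thesis
      using abs_dev_vimage[of B "\<lambda>b. {c, b}"] inj_on_edge[of c B] edges(2) c card_parts
      by (auto simp: insert_commute)
  qed
  then have "bexp p E (\<lambda>G. \<Sum>c\<in>C. max 0 (real (card ((leftover G t)\<inverse> `` {c})) - (p * q - p * t)))
    \<le> 2 * card C * sqrt q + bexp p E (\<lambda>G. \<Sum>c\<in>C. real (card {i \<in> {..<t}. {a i, c} \<in> G})
        - (real (card ((base G)\<inverse> `` {c})) - real (card ((leftover G t)\<inverse> `` {c}))))"
    by (intro bexp_sum_excess[OF p01 finite_E] abs_dev_star t)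
      (use card_base_converse_Image_le in \<open>auto simp: algebra_simps simp flip: of_nat_add\<close>)
  then show "bexp p E (\<lambda>G. \<Sum>c\<in>C. max 0 (real (card ((leftover G t)\<inverse> `` {c})) - (p * q - p * t))) \<le> 2 * q * sqrt q + shortfall t"
    unfolding bexp_star_excess[OF disjI2[OF refl] t] shortfall_def card_parts
      card_eq_sum_Image(2)[OF sub(1)] card_eq_sum_Image(2)[OF sub(2)] of_nat_sum .
qed

text \<open>Resamples the edges from \<open>a t\<close> to \<open>B\<close>, then those to
  \<open>C\<close>; neither change affects \<open>leftover G t\<close>.\<close>

lemma bexp_link_matching:
  assumes t: "t < q"
  shows "bexp p E (\<lambda>G. real (card (link_matching G t)))
    = bexp p E (\<lambda>G. bexp p B (\<lambda>X. bexp p C (\<lambda>Y. real (card (max_matching (leftover G t \<inter> X \<times> Y))))))"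
proof -
  have at: "a t \<notin> B" "a t \<notin> C" using t disjoint by auto
  have sub: "(\<lambda>x. {a t, x}) ` B \<subseteq> E" "(\<lambda>x. {a t, x}) ` C \<subseteq> E" using edges(1) t by auto
  have nC: "nbrs C (G - (\<lambda>x. {a t, x}) ` B) t = nbrs C G t" for G
    using disjoint(2) at by (auto simp: nbrs_def doubleton_eq_iff)
  have "bexp p E (\<lambda>G. real (card (link_matching G t)))
     = bexp p E (\<lambda>G. real (card (max_matching (leftover G t \<inter> {x \<in> B. {a t, x} \<in> G} \<times> nbrs C G t))))"
    by (simp only: link_matching_def nbrs_def)
  also have "\<dots> = bexp p E (\<lambda>G. bexp p B (\<lambda>X. real (card (max_matching (leftover G t \<inter> X \<times> nbrs C G t)))))"
    by (rule bexp_independent[OF p01 finite_E finite_parts(1) inj_on_edge[OF at(1)] sub(1),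
          of "\<lambda>G X. real (card (max_matching (leftover G t \<inter> X \<times> nbrs C G t)))"])
       (simp add: nC leftover_Diff_star t)
  also have "\<dots> = bexp p E (\<lambda>G. bexp p B (\<lambda>X. real (card (max_matching (leftover G t \<inter> X \<times> {x \<in> C. {a t, x} \<in> G})))))"
    by (simp only: nbrs_def)
  also have "\<dots> = bexp p E (\<lambda>G. bexp p C (\<lambda>Y. bexp p B (\<lambda>X. real (card (max_matching (leftover G t \<inter> X \<times> Y))))))"
    by (rule bexp_independent[OF p01 finite_E finite_parts(2) inj_on_edge[OF at(2)] sub(2),
          of "\<lambda>G Y. bexp p B (\<lambda>X. real (card (max_matching (leftover G t \<inter> X \<times> Y))))"])
       (simp add: leftover_Diff_star t)
  finally show ?thesis by (simp only: bexp_swap[OF p01 finite_parts])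
qed

text \<open>Divide everything by \<open>p\<^sup>2\<close>. The link has
  \<open>p * q * r + shortfall t\<close> edges in expectation, a matching of the ideal size
  \<open>p * q\<close> accounts for \<open>p * q * r\<close>, and the excess on each side costs
  \<open>2 * q * sqrt q + shortfall t\<close>. Past failures thus hurt twice but leave extra edges
  once, so \<open>shortfall t\<close> remains with coefficient 1. The constant 6 is 4 from these
  excesses plus 2 from the deviations in the link.\<close>

lemma shortfall_Suc:
  assumes t: "t < q"
  shows "(real q - t) * (shortfall (Suc t) - shortfall t) \<le> shortfall t + 6 * q * sqrt q"
proof -
  define s where "s = sqrt q"
  define r where "r = real q - t"
  have s: "s > 0" "s * s = q" using card_parts(3) by (simp_all add: s_def)
  have r: "r > 0" using t by (simp add: r_def)
  \<comment> \<open>the degree to be expected in the link of \<open>a t\<close>\<close>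
  define D where "D = p * (p * r)"
  define inner where "inner G = bexp p B (\<lambda>X. bexp p C (\<lambda>Y. real (card (max_matching (leftover G t \<inter> X \<times> Y)))))" for G
  define eB where "eB G = (\<Sum>b\<in>B. max 0 (real (card (leftover G t `` {b})) - (p * q - p * t)))" for G
  define eC where "eC G = (\<Sum>c\<in>C. max 0 (real (card ((leftover G t)\<inverse> `` {c})) - (p * q - p * t)))" for G
  have max_eq: "max 0 (p * x - D) = p * max 0 (x - (p * q - p * t))" for x
  proof -
    have "p * x - D = p * (x - (p * q - p * t))" by (simp add: D_def r_def algebra_simps)
    then show ?thesis using p by (simp add: max_mult_distrib_left)
  qed
  \<comment> \<open>This is the deviation bound with \<alpha> = \<open>p * s\<close>: typical
    degrees in the base graph are about \<open>p * q\<close>, and a random part of such a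
    neighbourhood has standard deviation at most about \<open>p * s\<close>.\<close>
  have dev: "(p * s + p * x / (p * s)) / 2 = p * s / 2 + x / (2 * s)" for x
    using p s by (simp add: field_simps)
  have sub: "leftover G t \<subseteq> B \<times> C" for G
    using leftover_subset base_subset by (meson order_trans)
  have step: "p\<^sup>2 * card (leftover G t) - p\<^sup>2 * eB G - p\<^sup>2 * eC G - (p\<^sup>2 * q * s + p / s * card (base G)) \<le> D * inner G" for G
  proof -
    have "p\<^sup>2 * card (leftover G t)
      - p * (\<Sum>b\<in>B. max 0 (p * card (leftover G t `` {b}) - D) + (p * s + p * card (leftover G t `` {b}) / (p * s)) / 2)
      - p * (\<Sum>c\<in>C. max 0 (p * card ((leftover G t)\<inverse> `` {c}) - D) + (p * s + p * card ((leftover G t)\<inverse> `` {c}) / (p * s)) / 2)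
      \<le> D * inner G"
      unfolding inner_def
      by (rule bexp_max_matching_ge[OF p01 sub finite_parts]) (use p s r in \<open>auto simp: D_def\<close>)
    moreover have "(\<Sum>b\<in>B. max 0 (p * card (leftover G t `` {b}) - D) + (p * s + p * card (leftover G t `` {b}) / (p * s)) / 2)
       = p * eB G + (q * p * s / 2 + card (leftover G t) / (2 * s))"
      unfolding max_eq dev eB_def card_eq_sum_Image(1)[OF sub]
      by (simp add: sum.distrib sum_distrib_left sum_divide_distrib card_parts)
    moreover have "(\<Sum>c\<in>C. max 0 (p * card ((leftover G t)\<inverse> `` {c}) - D) + (p * s + p * card ((leftover G t)\<inverse> `` {c}) / (p * s)) / 2)
       = p * eC G + (q * p * s / 2 + card (leftover G t) / (2 * s))"
      unfolding max_eq dev eC_def card_eq_sum_Image(2)[OF sub]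
      by (simp add: sum.distrib sum_distrib_left sum_divide_distrib card_parts)
    \<comment> \<open>Passing to the base graph is affordable in this error term, and its expected
      size is known exactly.\<close>
    moreover have "p / s * card (leftover G t) \<le> p / s * card (base G)"
      using p s card_mono[OF finite_leftover(1) leftover_subset] by (intro mult_left_mono) auto
    ultimately show ?thesis by (simp add: algebra_simps power2_eq_square add_divide_distrib)
  qed
  have EL: "bexp p E (\<lambda>G. real (card (leftover G t))) = p * q * r + shortfall t"
    using bexp_card_base
    by (simp add: shortfall_def bexp_diff[OF p01 finite_E] r_def algebra_simps power2_eq_square)
  have EM: "shortfall (Suc t) - shortfall t = p * q - bexp p E (\<lambda>G. real (card (link_matching G t)))"
  proof -
    have "real (card (leftover G t)) = real (card (leftover G (Suc t))) + real (card (link_matching G t))" for G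
      using card_leftover_Suc[of G t] by (simp flip: of_nat_add)
    then show ?thesis
      by (simp add: shortfall_def bexp_diff[OF p01 finite_E] bexp_add[OF p01 finite_E] algebra_simps)
  qed
  have "p / s * (p * q\<^sup>2) = p\<^sup>2 * q * s"
    using s by (simp add: power2_eq_square divide_simps)
  then have "p\<^sup>2 * (p * q * r + shortfall t) - p\<^sup>2 * bexp p E eB - p\<^sup>2 * bexp p E eC - 2 * p\<^sup>2 * q * s
    = bexp p E (\<lambda>G. p\<^sup>2 * card (leftover G t) - p\<^sup>2 * eB G - p\<^sup>2 * eC G - (p\<^sup>2 * q * s + p / s * card (base G)))"
    by (simp only: bexp_diff[OF p01 finite_E] bexp_add[OF p01 finite_E] bexp_cmult[OF p01 finite_E]
        bexp_const[OF p01 finite_E] EL bexp_card_base)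
  also have "\<dots> \<le> bexp p E (\<lambda>G. D * inner G)"
    by (rule bexp_mono[OF p01 finite_E]) (rule step)
  also have "\<dots> = D * bexp p E (\<lambda>G. real (card (link_matching G t)))"
    by (simp only: bexp_cmult[OF p01 finite_E] inner_def bexp_link_matching[OF t])
  finally have 1: "p\<^sup>2 * (p * q * r + shortfall t) - p\<^sup>2 * bexp p E eB - p\<^sup>2 * bexp p E eC - 2 * p\<^sup>2 * q * s
    \<le> D * (p * q - (shortfall (Suc t) - shortfall t))"
    unfolding EM by simp
  have "p\<^sup>2 * bexp p E eB \<le> p\<^sup>2 * (2 * q * s + shortfall t)" "p\<^sup>2 * bexp p E eC \<le> p\<^sup>2 * (2 * q * s + shortfall t)"
    unfolding eB_def eC_def s_def using t by (intro mult_left_mono bexp_excess_leftover; simp)+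
  with 1 have "p\<^sup>2 * (r * (shortfall (Suc t) - shortfall t)) \<le> p\<^sup>2 * (shortfall t + 6 * q * s)"
    by (simp add: D_def power2_eq_square algebra_simps)
  then show ?thesis
    using p by (simp add: r_def s_def)
qed

text \<open>The recurrence says that
  \<open>(shortfall t + 6 * q * sqrt q) * (real q - t + 1)\<close> does not increase with
  \<open>t\<close>; at \<open>t = 0\<close> it equals the numerator.\<close>

lemma shortfall_le:
  assumes "t \<le> q"
  shows "shortfall t \<le> 6 * q * sqrt q * (q + 1) / (real q - t + 1)"
proof -
  have "(shortfall t + 6 * q * sqrt q) * (real q - t + 1) \<le> 6 * q * sqrt q * (q + 1)"
    using assms
  proof (induction t)
    case (Suc t)
    then show ?case using shortfall_Suc[of t] by (simp add: algebra_simps)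
  qed (simp add: shortfall_0 algebra_simps)
  moreover have "0 \<le> 6 * q * sqrt q * (real q - t + 1)" using assms by simp
  ultimately have "shortfall t * (real q - t + 1) \<le> 6 * q * sqrt q * (q + 1)"
    by (simp only: distrib_right)
  then show ?thesis using assms by (subst pos_le_divide_eq) auto
qed

lemma card_removed: "card (base G) = card (leftover G t) + (\<Sum>i<t. card (link_matching G i))"
proof (induction t)
  case (Suc t)
  then show ?case using card_leftover_Suc[of G t] by simp
qed simp

lemma expected_matched_ge:
  assumes "t \<le> q"
  shows "bexp p E (\<lambda>G. real (\<Sum>i<t. card (link_matching G i)))
    \<ge> p * q * t - 6 * q * sqrt q * (q + 1) / (real q - t + 1)"
proof -
  have "real (\<Sum>i<t. card (link_matching G i)) = real (card (base G)) - real (card (leftover G t))" for G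
    using card_removed[of G t] by linarith
  then show ?thesis using shortfall_le[OF assms] by (simp add: shortfall_def)
qed

section \<open>Edge-disjoint triangles from the link matchings\<close>

lemma link_matching_disjoint:
  assumes "i < j"
  shows "link_matching G i \<inter> link_matching G j = {}"
proof -
  have "leftover G (Suc i) \<supseteq> leftover G (Suc i + k)" for k
    by (induction k) (auto simp: leftover_Suc)
  from this[of "j - Suc i"] have "leftover G j \<subseteq> leftover G (Suc i)" using assms by simp
  then show ?thesis using link_matching(1)[of G j] by (auto simp: leftover_Suc)
qed

definition process_triangles :: "'v set set \<Rightarrow> nat \<Rightarrow> 'v set set" where
  "process_triangles G t = (\<lambda>(i, b, c). {a i, b, c}) ` (SIGMA i:{..<t}. link_matching G i)"

lemma link_matching_edges:
  assumes "(b, c) \<in> link_matching G i" "i < q"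
  shows "b \<in> B" "c \<in> C" "{a i, b} \<in> G" "{a i, c} \<in> G" "{b, c} \<in> G"
    "a i \<noteq> b" "a i \<noteq> c" "b \<noteq> c"
proof -
  have "(b, c) \<in> base G" "b \<in> nbrs B G i" "c \<in> nbrs C G i"
    using assms(1) link_matching(1)[of G i] leftover_subset[of G i] by auto
  then show "b \<in> B" "c \<in> C" "{a i, b} \<in> G" "{a i, c} \<in> G" "{b, c} \<in> G"
    by (auto simp: nbrs_def base_def)
  moreover have "a i \<in> a ` {..<q}" using assms(2) by simp
  ultimately show "a i \<noteq> b" "a i \<noteq> c" "b \<noteq> c"
    using disjoint by blast+
qed

text \<open>A common edge at a vertex \<open>a i\<close> puts both triangles in the same step, where
  the matching property identifies them. A common edge between \<open>B\<close> and \<open>C\<close>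
  also forces the same step, because matched edges leave \<open>leftover\<close> for good.\<close>

lemma process_triangles_disjoint:
  assumes x: "(b, c) \<in> link_matching G i" "i < q" and y: "(b', c') \<in> link_matching G j" "j < q"
    and e: "e \<in> vertex_pairs {a i, b, c}" "e \<in> vertex_pairs {a j, b', c'}"
  shows "i = j \<and> b = b' \<and> c = c'"
proof -
  note X = link_matching_edges[OF x] and Y = link_matching_edges[OF y]
  have neq: "a k \<noteq> z" if "z \<in> B \<union> C" "k < q" for k z
  proof -
    have "a k \<in> a ` {..<q}" using that by simp
    then show ?thesis using disjoint(1) that by blast
  qed
  have neq2: "b \<noteq> c'" "b' \<noteq> c" using disjoint(2) X(1,2) Y(1,2) by blast+
  have n: "a i \<noteq> b'" "a i \<noteq> c'" "a j \<noteq> b" "a j \<noteq> c"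
    using neq X(1,2) Y(1,2) x(2) y(2) by blast+
  have "e \<in> {{a i, b}, {a i, c}, {b, c}}" "e \<in> {{a j, b'}, {a j, c'}, {b', c'}}"
    using e X Y by (simp_all add: vertex_pairs_triple)
  then have "a i = a j \<and> b = b' \<or> a i = a j \<and> c = c' \<or> b = b' \<and> c = c'"
    using n neq2 by (elim insertE emptyE; metis doubleton_eq_iff)
  then consider "a i = a j" "b = b'" | "a i = a j" "c = c'" | "b = b'" "c = c'"
    by blast
  then show ?thesis
  proof cases
    case 1
    have "i = j" using inj_onD[OF inj_a 1(1)] x(2) y(2) by simp
    then show ?thesis using inj_onD[OF link_matching(2)[of G i], of "(b, c)" "(b', c')"] 1 x(1) y(1) by simp
  next
    case 2
    have "i = j" using inj_onD[OF inj_a 2(1)] x(2) y(2) by simp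
    then show ?thesis using inj_onD[OF link_matching(3)[of G i], of "(b, c)" "(b', c')"] 2 x(1) y(1) by simp
  next
    case 3
    then show ?thesis using x(1) y(1) link_matching_disjoint[of i j G] link_matching_disjoint[of j i G]
      by (cases i j rule: linorder_cases) auto
  qed
qed

lemma card_process_triangles:
  assumes "t \<le> q"
  shows "card (process_triangles G t) = (\<Sum>i<t. card (link_matching G i))"
proof -
  have "inj_on (\<lambda>(i, b, c). {a i, b, c}) (SIGMA i:{..<t}. link_matching G i)"
  proof (rule inj_onI)
    fix x y
    assume "x \<in> (SIGMA i:{..<t}. link_matching G i)" "y \<in> (SIGMA i:{..<t}. link_matching G i)"
      "(\<lambda>(i, b, c). {a i, b, c}) x = (\<lambda>(i, b, c). {a i, b, c}) y"
    then obtain i b c j b' c' where xy: "x = (i, b, c)" "y = (j, b', c')"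
      and *: "i < t" "(b, c) \<in> link_matching G i" "j < t" "(b', c') \<in> link_matching G j"
        "{a i, b, c} = {a j, b', c'}"
      by auto
    have iq: "i < q" "j < q" using *(1,3) assms by simp_all
    note X = link_matching_edges[OF *(2) iq(1)]
    \<comment> \<open>Equal triangles share this edge, so injectivity is an instance of
      edge-disjointness.\<close>
    have e: "{a i, b} \<in> vertex_pairs {a i, b, c}"
      unfolding vertex_pairs_triple[OF X(6-8)] by blast
    show "x = y"
      using process_triangles_disjoint[OF *(2) iq(1) *(4) iq(2) e] e[unfolded *(5)] xy by simp
  qed
  then show ?thesis
    unfolding process_triangles_def by (subst card_image) auto
qed

lemma process_triangles_edge_disjoint:
  assumes "t \<le> q"
  shows "pairwise (\<lambda>s t. disjnt (vertex_pairs s) (vertex_pairs t)) (process_triangles G t)"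
proof (rule pairwiseI)
  fix s s' assume ss: "s \<in> process_triangles G t" "s' \<in> process_triangles G t" "s \<noteq> s'"
  obtain i b c where x: "(b, c) \<in> link_matching G i" "i < t" and s: "s = {a i, b, c}"
    using ss(1) by (auto simp: process_triangles_def)
  obtain j b' c' where y: "(b', c') \<in> link_matching G j" "j < t" and s': "s' = {a j, b', c'}"
    using ss(2) by (auto simp: process_triangles_def)
  have iq: "i < q" "j < q" using x(2) y(2) assms by simp_all
  show "disjnt (vertex_pairs s) (vertex_pairs s')"
    unfolding disjnt_iff s s'
    using process_triangles_disjoint[OF x(1) iq(1) y(1) iq(2)] ss(3)[unfolded s s'] by blast
qed

lemma process_triangles_transversal:
  assumes "s \<in> process_triangles G t" "t \<le> q"
  obtains i b c where "s = {a i, b, c}" "i < q" "b \<in> B" "c \<in> C" "card s = 3" "vertex_pairs s \<subseteq> G"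
proof -
  from assms obtain i b c where *: "s = {a i, b, c}" "i < q" "(b, c) \<in> link_matching G i"
    by (auto simp: process_triangles_def)
  note X = link_matching_edges[OF *(3,2)]
  have "card s = 3" "vertex_pairs s \<subseteq> G"
    using X unfolding *(1) by (simp_all add: vertex_pairs_triple)
  then show thesis using that * X by blast
qed

end

section \<open>Reduction to tripartite graphs\<close>

lemma finite_vertex_pairs [simp]: "finite V \<Longrightarrow> finite (vertex_pairs V)"
  unfolding vertex_pairs_def by (rule finite_subset[of _ "Pow V"]) auto

lemma card_vertex_pairs: "finite V \<Longrightarrow> card (vertex_pairs V) = card V choose 2"
  unfolding vertex_pairs_def by (rule n_subsets)

lemma card_le_triangle_packing_number:
  assumes "finite (fst H)" "edge_disjoint_triangles H T"
  shows "card T \<le> triangle_packing_number H"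
  unfolding triangle_packing_number_def
  using triangle_packing_number_Max_defined(1)[OF assms(1)] assms(2) by (intro Max_ge) auto

lemma triangle_packing_number_le:
  assumes "finite V" "G \<subseteq> vertex_pairs V"
  shows "3 * triangle_packing_number (V, G) \<le> card G"
proof -
  have "triangle_packing_number (V, G) \<in> {card T | T. edge_disjoint_triangles (V, G) T}"
    unfolding triangle_packing_number_def
    using triangle_packing_number_Max_defined[of "(V, G)"] assms(1) by (intro Max_in) auto
  then obtain T where T: "edge_disjoint_triangles (V, G) T" "triangle_packing_number (V, G) = card T"
    by auto
  have tr: "t \<subseteq> V" "card t = 3" "vertex_pairs t \<subseteq> G" if "t \<in> T" for t
    using T(1) that by (auto simp: edge_disjoint_triangles_def triangles_def)
  have "T \<subseteq> Pow V" using tr by auto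
  then have finT: "finite T" using assms(1) finite_subset by blast
  have "card (vertex_pairs t) = 3" if "t \<in> T" for t
  proof -
    have "card (vertex_pairs t) = card t choose 2"
      using card_vertex_pairs[OF finite_subset[OF tr(1)[OF that] assms(1)]] .
    also have "\<dots> = 3" unfolding tr(2)[OF that] by (simp add: choose_two)
    finally show ?thesis .
  qed
  then have "(\<Sum>t\<in>T. card (vertex_pairs t)) = 3 * card T" by simp
  moreover have "card (\<Union>t\<in>T. vertex_pairs t) = (\<Sum>t\<in>T. card (vertex_pairs t))"
  proof (rule card_UN_disjoint[OF finT])
    show "\<forall>t\<in>T. finite (vertex_pairs t)"
      using finite_vertex_pairs[OF finite_subset[OF tr(1) assms(1)]] by blast
    show "\<forall>s\<in>T. \<forall>t\<in>T. s \<noteq> t \<longrightarrow> vertex_pairs s \<inter> vertex_pairs t = {}"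
      using T(1) by (auto simp: edge_disjoint_triangles_def pairwise_def disjnt_def)
  qed
  moreover have "card (\<Union>t\<in>T. vertex_pairs t) \<le> card G"
    using tr(3) finite_subset[OF assms(2)] assms(1) by (intro card_mono) auto
  ultimately show ?thesis using T(2) by simp
qed

text \<open>A partial Steiner triple system obtained from addition modulo \<open>N\<close>: two
  points determine the third, and the pairs left uncovered are those whose third point would repeat
  one of the two.\<close>

definition zero_sum_triples :: "nat \<Rightarrow> nat set set" where
  "zero_sum_triples N = {S. S \<subseteq> {..<N} \<and> card S = 3 \<and> N dvd \<Sum>S}"

lemma finite_zero_sum_triples [simp]: "finite (zero_sum_triples N)"
  unfolding zero_sum_triples_def by (rule finite_subset[of _ "Pow {..<N}"]) auto

lemma dvd_add_less_unique:
  fixes j j' :: nat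
  assumes "N dvd x + j" "N dvd x + j'" "j < N" "j' < N"
  shows "j = j'"
proof -
  have "N dvd j - j'" "N dvd j' - j"
    using dvd_diff_nat[OF assms(1,2)] dvd_diff_nat[OF assms(2,1)] by simp_all
  moreover have "j - j' < N" "j' - j < N" using assms(3,4) by auto
  ultimately have "j - j' = 0" "j' - j = 0" by (meson nat_dvd_not_less gr0I)+
  then show ?thesis by simp
qed

lemma zero_sum_triples_inter:
  assumes "S \<in> zero_sum_triples N" "S' \<in> zero_sum_triples N" "D \<subseteq> S" "D \<subseteq> S'" "card D = 2"
  shows "S = S'"
proof -
  have S: "finite S" "S \<subseteq> {..<N}" "card S = 3" "N dvd \<Sum>S" "finite S'" "S' \<subseteq> {..<N}" "card S' = 3" "N dvd \<Sum>S'"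
    using assms(1,2) finite_subset by (auto simp: zero_sum_triples_def)
  have D: "finite D" using assms(3) S(1) finite_subset by blast
  have "card (S - D) = 1" "card (S' - D) = 1"
    using assms(3-5) S D by (simp_all add: card_Diff_subset)
  then obtain x y where xy: "S - D = {x}" "S' - D = {y}" by (auto simp: card_1_singleton_iff)
  have "\<Sum>S = \<Sum>D + x" "\<Sum>S' = \<Sum>D + y"
    using sum.subset_diff[OF assms(3) S(1), of id] sum.subset_diff[OF assms(4) S(5), of id] xy by simp_all
  moreover have "x < N" "y < N" using xy S by auto
  ultimately have "x = y" using dvd_add_less_unique[of N "\<Sum>D" x y] S by simp
  then show ?thesis using xy assms(3,4) by blast
qed

text \<open>Counts ordered pairs (i, j). Those on the diagonal, and those whose completion repeats i
  or repeats j, number at most \<open>N\<close> each; all others are among the 6 ordered pairs of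
  distinct points of some triple.\<close>

lemma card_zero_sum_triples: "N\<^sup>2 \<le> 6 * card (zero_sum_triples N) + 3 * N"
proof -
  let ?P = "{..<N} \<times> {..<N}"
  define B1 where "B1 = {x \<in> ?P. fst x = snd x}"
  define B2 where "B2 = {x \<in> ?P. N dvd 2 * fst x + snd x}"
  define B3 where "B3 = {x \<in> ?P. N dvd 2 * snd x + fst x}"
  define W where "W = (\<Union>S\<in>zero_sum_triples N. S \<times> S - (\<lambda>x. (x, x)) ` S)"
  have fin: "finite B1" "finite B2" "finite B3"
    unfolding B1_def B2_def B3_def by simp_all
  have "card B1 \<le> card {..<N}" "card B2 \<le> card {..<N}"
    by (rule card_inj_on_le[of fst]; auto simp: B1_def B2_def inj_on_def dest: dvd_add_less_unique)+
  moreover have "card B3 \<le> card {..<N}"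
    by (rule card_inj_on_le[of snd]; auto simp: B3_def inj_on_def dest: dvd_add_less_unique)
  moreover have "card W \<le> 6 * card (zero_sum_triples N)"
  proof -
    have "card (S \<times> S - (\<lambda>x. (x, x)) ` S) \<le> 6" if "S \<in> zero_sum_triples N" for S
    proof -
      have S: "finite S" "card S = 3"
        using that by (auto simp: zero_sum_triples_def intro: finite_subset)
      have "card ((\<lambda>x. (x, x)) ` S) = 3" using S by (subst card_image) (auto simp: inj_on_def)
      then show ?thesis
        using S by (subst card_Diff_subset) (auto simp: card_cartesian_product)
    qed
    then have "(\<Sum>S\<in>zero_sum_triples N. card (S \<times> S - (\<lambda>x. (x, x)) ` S)) \<le> (\<Sum>S\<in>zero_sum_triples N. 6)"
      by (rule sum_mono)
    moreover have "card W \<le> (\<Sum>S\<in>zero_sum_triples N. card (S \<times> S - (\<lambda>x. (x, x)) ` S))"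
      unfolding W_def by (rule card_UN_le) simp
    ultimately show ?thesis by simp
  qed
  moreover have "finite W"
    unfolding W_def by (auto simp: zero_sum_triples_def intro!: finite_subset[of _ "Pow {..<N}"] finite_subset[of _ "{..<N}"])
  moreover have "?P \<subseteq> W \<union> (B1 \<union> (B2 \<union> B3))"
  proof (rule subsetI, rule UnCI)
    fix x assume x: "x \<in> ?P" and notin: "x \<notin> B1 \<union> (B2 \<union> B3)"
    obtain i j where x_eq: "x = (i, j)" by (cases x)
    then have ij: "i < N" "j < N" using x by auto
    then have "i \<noteq> j" "\<not> N dvd 2 * i + j" "\<not> N dvd 2 * j + i" "i \<in> {..<N}" "j \<in> {..<N}"
      using notin x_eq by (auto simp: B1_def B2_def B3_def)
    \<comment> \<open>Starting from \<open>2 * N\<close> keeps the natural-number subtraction from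
      truncating.\<close>
    define k where "k = (2 * N - i - j) mod N"
    have k: "k < N" using ij by (simp add: k_def)
    have "(i + j + k) mod N = (i + j + (2 * N - i - j)) mod N"
      unfolding k_def by (simp add: mod_add_right_eq)
    also have "\<dots> = 0" using ij by simp
    finally have dvd: "N dvd i + j + k" by (simp add: mod_eq_0_iff_dvd)
    have "i + j + i = 2 * i + j" "i + j + j = 2 * j + i" by simp_all
    then have "k \<noteq> i" "k \<noteq> j"
      using dvd \<open>\<not> N dvd 2 * i + j\<close> \<open>\<not> N dvd 2 * j + i\<close> by metis+
    then have "{i, j, k} \<in> zero_sum_triples N"
      using ij k dvd \<open>i \<noteq> j\<close> by (simp add: zero_sum_triples_def add.assoc)
    moreover have "(i, j) \<in> {i, j, k} \<times> {i, j, k} - (\<lambda>x. (x, x)) ` {i, j, k}"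
      using \<open>i \<noteq> j\<close> by auto
    ultimately show "x \<in> W" unfolding W_def x_eq by (rule UN_I)
  qed
  then have "card ?P \<le> card W + (card B1 + (card B2 + card B3))"
    using card_mono[of "W \<union> (B1 \<union> (B2 \<union> B3))" ?P] fin \<open>finite W\<close> card_Un_le[of W "B1 \<union> (B2 \<union> B3)"]
      card_Un_le[of B1 "B2 \<union> B3"] card_Un_le[of B2 B3] by simp
  ultimately show ?thesis
    by (simp add: card_cartesian_product power2_eq_square)
qed

text \<open>Vertices are numbered from 1, hence the shift. A vertex above \<open>N * q\<close> has
  index at least \<open>N\<close> and so meets no triple.\<close>

definition part_index :: "nat \<Rightarrow> nat \<Rightarrow> nat" where
  "part_index q v = (v - 1) div q"

lemma part_index_eq:
  assumes "i * q < v" "v \<le> i * q + q"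
  shows "part_index q v = i"
  unfolding part_index_def
  by (rule div_nat_eqI) (use assms in \<open>auto simp: mult.commute\<close>)

text \<open>Runs the process on the three classes named by \<open>S\<close>. Recording that each
  triangle has exactly \<open>S\<close> as its set of class indices is what later separates the
  packings of different triples.\<close>

lemma transversal_packing:
  fixes n N q t :: nat and p :: real
  assumes p: "0 < p" "p \<le> 1" and q: "0 < q" "N * q \<le> n" and t: "t \<le> q"
    and S: "S \<in> zero_sum_triples N"
  shows "\<exists>P. (\<forall>G. edge_disjoint_triangles ({1..n}, G) (P G) \<and> (\<forall>s\<in>P G. part_index q ` s = S)) \<and>
     bexp p (vertex_pairs {1..n}) (\<lambda>G. real (card (P G))) \<ge> p * q * t - 6 * q * sqrt q * (q + 1) / (real q - t + 1)"
proof -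
  obtain i j k where ijk: "S = {i, j, k}" "i \<noteq> j" "i \<noteq> k" "j \<noteq> k" "i < N" "j < N" "k < N"
    using S by (auto simp: zero_sum_triples_def card_3_iff)
  define V where "V l = {l * q<..l * q + q}" for l
  define a where "a r = i * q + 1 + r" for r
  have idx: "part_index q v = l" if "v \<in> V l" for v l
    using that part_index_eq by (auto simp: V_def)
  have V_sub: "V l \<subseteq> {1..n}" if "l < N" for l
  proof -
    have "Suc l * q \<le> N * q" using that by (intro mult_le_mono1) simp
    then show ?thesis using q(2) by (auto simp: V_def)
  qed
  have V_disj: "V l \<inter> V l' = {}" if "l \<noteq> l'" for l l'
    using idx that by blast
  have a: "a r \<in> V i" if "r < q" for r
    using that by (auto simp: a_def V_def)
  have edge: "{x, y} \<in> vertex_pairs {1..n}" if "x \<in> V l" "y \<in> V l'" "l \<noteq> l'" "l < N" "l' < N" for x y l l'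
  proof -
    have "x \<noteq> y" using V_disj[OF that(3)] that(1,2) by blast
    moreover have "{x, y} \<subseteq> {1..n}" using V_sub[OF that(4)] V_sub[OF that(5)] that(1,2) by blast
    ultimately show ?thesis unfolding vertex_pairs_def by simp
  qed
  interpret triangle_process p q "vertex_pairs {1..n}" a "V j" "V k"
  proof
    show "card (V j) = q" "card (V k) = q" by (simp_all add: V_def)
    show "inj_on a {..<q}" by (auto simp: a_def inj_on_def)
    show "a ` {..<q} \<inter> (V j \<union> V k) = {}" using a V_disj[OF ijk(2)] V_disj[OF ijk(3)] by blast
    show "V j \<inter> V k = {}" using V_disj[OF ijk(4)] .
    show "{a r, x} \<in> vertex_pairs {1..n}" if "r < q" "x \<in> V j \<union> V k" for r x
      using edge[OF a[OF that(1)] _ ijk(2,5,6)] edge[OF a[OF that(1)] _ ijk(3,5,7)] that(2) by blast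
    show "{b, c} \<in> vertex_pairs {1..n}" if "b \<in> V j" "c \<in> V k" for b c
      using edge[OF that ijk(4,6,7)] .
  qed (use p q in simp_all)
  have "edge_disjoint_triangles ({1..n}, G) (process_triangles G t) \<and> (\<forall>s\<in>process_triangles G t. part_index q ` s = S)" for G
  proof -
    have *: "s \<in> triangles ({1..n}, G) \<and> part_index q ` s = S" if "s \<in> process_triangles G t" for s
      using that t
    proof (rule process_triangles_transversal)
      fix r b c assume s: "s = {a r, b, c}" "r < q" "b \<in> V j" "c \<in> V k" "card s = 3" "vertex_pairs s \<subseteq> G"
      have "s \<subseteq> {1..n}" using s(3,4) a[OF s(2)] V_sub[OF ijk(5)] V_sub[OF ijk(6)] V_sub[OF ijk(7)] unfolding s(1) by blast
      moreover have "part_index q ` s = S" using idx[OF a[OF s(2)]] idx[OF s(3)] idx[OF s(4)] unfolding s(1) ijk(1) by simp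
      ultimately show ?thesis using s(5,6) by (simp add: triangles_def)
    qed
    then show ?thesis
      using process_triangles_edge_disjoint[OF t] by (auto simp: edge_disjoint_triangles_def)
  qed
  moreover have "p * q * t - 6 * q * sqrt q * (q + 1) / (real q - t + 1)
      \<le> bexp p (vertex_pairs {1..n}) (\<lambda>G. real (card (process_triangles G t)))"
    using expected_matched_ge[OF t] by (simp only: card_process_triangles[OF t])
  ultimately show ?thesis
    by (intro exI[of _ "\<lambda>G. process_triangles G t"] conjI allI) (assumption | blast)+
qed

lemma expected_packing_number_ge:
  fixes n N q t :: nat and p :: real
  assumes p: "0 < p" "p \<le> 1" and q: "0 < q" "N * q \<le> n" and t: "t \<le> q"
  shows "bexp p (vertex_pairs {1..n}) (\<lambda>G. real (triangle_packing_number ({1..n}, G)))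
    \<ge> card (zero_sum_triples N) * (p * q * t - 6 * q * sqrt q * (q + 1) / (real q - t + 1))"
proof -
  let ?E = "vertex_pairs {1..n}" and ?Z = "zero_sum_triples N"
  have p01: "0 \<le> p" "p \<le> 1" using p by auto
  have finE: "finite ?E" by simp
  have "\<forall>S\<in>?Z. \<exists>P. (\<forall>G. edge_disjoint_triangles ({1..n}, G) (P G) \<and> (\<forall>s\<in>P G. part_index q ` s = S)) \<and>
     bexp p ?E (\<lambda>G. real (card (P G))) \<ge> p * q * t - 6 * q * sqrt q * (q + 1) / (real q - t + 1)"
    using transversal_packing[OF p q t] by blast
  from bchoice[OF this] obtain P where
    P0: "\<forall>S\<in>?Z. (\<forall>G. edge_disjoint_triangles ({1..n}, G) (P S G) \<and> (\<forall>s\<in>P S G. part_index q ` s = S)) \<and>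
     bexp p ?E (\<lambda>G. real (card (P S G))) \<ge> p * q * t - 6 * q * sqrt q * (q + 1) / (real q - t + 1)"
    by (rule exE)
  have P: "\<And>S G. S \<in> ?Z \<Longrightarrow> edge_disjoint_triangles ({1..n}, G) (P S G)"
      "\<And>S G s. S \<in> ?Z \<Longrightarrow> s \<in> P S G \<Longrightarrow> part_index q ` s = S"
      "\<And>S. S \<in> ?Z \<Longrightarrow> bexp p ?E (\<lambda>G. real (card (P S G))) \<ge> p * q * t - 6 * q * sqrt q * (q + 1) / (real q - t + 1)"
    using P0 by blast+
  have P_tri: "P S G \<subseteq> triangles ({1..n}, G)" if "S \<in> ?Z" for S G
    using P(1)[OF that, of G] unfolding edge_disjoint_triangles_def by blast
  have tri: "s \<subseteq> {1..n}" "card s = 3" if "S \<in> ?Z" "s \<in> P S G" for S s G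
  proof -
    have "s \<in> triangles ({1..n}, G)" using subsetD[OF P_tri[OF that(1)] that(2)] .
    then show "s \<subseteq> {1..n}" "card s = 3" unfolding triangles_def by auto
  qed
  have "(\<Sum>S\<in>?Z. card (P S G)) \<le> triangle_packing_number ({1..n}, G)" for G
  proof -
    have fin: "finite (P S G)" if "S \<in> ?Z" for S
    proof (rule finite_subset)
      show "P S G \<subseteq> Pow {1..n}" using tri(1)[OF that] by blast
    qed simp
    have "edge_disjoint_triangles ({1..n}, G) (\<Union>S\<in>?Z. P S G)"
      unfolding edge_disjoint_triangles_def
    proof (intro conjI pairwiseI)
      show "(\<Union>S\<in>?Z. P S G) \<subseteq> triangles ({1..n}, G)"
        using P_tri by blast
      fix s s' assume "s \<in> (\<Union>S\<in>?Z. P S G)" "s' \<in> (\<Union>S\<in>?Z. P S G)" and ne: "s \<noteq> s'"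
      then obtain S S' where S: "S \<in> ?Z" "s \<in> P S G" "S' \<in> ?Z" "s' \<in> P S' G" by blast
      show "disjnt (vertex_pairs s) (vertex_pairs s')"
      proof (cases "S = S'")
        case True
        then show ?thesis
          using P(1)[OF S(1), of G] S ne unfolding edge_disjoint_triangles_def pairwise_def by blast
      next
        case False
        show ?thesis unfolding disjnt_iff
        proof (intro allI notI)
          fix e assume "e \<in> vertex_pairs s \<and> e \<in> vertex_pairs s'"
          then have e: "e \<subseteq> s" "e \<subseteq> s'" "card e = 2" by (auto simp: vertex_pairs_def)
          \<comment> \<open>The three vertices of \<open>s\<close> have three different class
            indices, so a common edge of \<open>s\<close> and \<open>s'\<close> would give a pair of
            indices common to \<open>S\<close> and \<open>S'\<close>.\<close>
          have "finite s" using tri(1)[OF S(1,2)] finite_subset by blast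
          moreover have "card (part_index q ` s) = card s"
            using P(2)[OF S(1,2)] S(1) tri(2)[OF S(1,2)] by (simp add: zero_sum_triples_def)
          ultimately have "inj_on (part_index q) s" by (rule eq_card_imp_inj_on)
          then have "card (part_index q ` e) = 2" using e by (simp add: card_image inj_on_subset)
          moreover have "part_index q ` e \<subseteq> S" "part_index q ` e \<subseteq> S'"
            using P(2)[OF S(1,2)] P(2)[OF S(3,4)] e by blast+
          ultimately show False using zero_sum_triples_inter[OF S(1,3)] False by blast
        qed
      qed
    qed
    then have "card (\<Union>S\<in>?Z. P S G) \<le> triangle_packing_number ({1..n}, G)"
      by (intro card_le_triangle_packing_number) auto
    moreover have "card (\<Union>S\<in>?Z. P S G) = (\<Sum>S\<in>?Z. card (P S G))"
    proof (rule card_UN_disjoint)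
      show "\<forall>S\<in>?Z. \<forall>S'\<in>?Z. S \<noteq> S' \<longrightarrow> P S G \<inter> P S' G = {}"
        using P(2) by blast
    qed (use fin in auto)
    ultimately show ?thesis by simp
  qed
  then have le: "(\<Sum>S\<in>?Z. real (card (P S G))) \<le> real (triangle_packing_number ({1..n}, G))" for G
    by (metis of_nat_le_iff of_nat_sum)
  have "card ?Z * (p * q * t - 6 * q * sqrt q * (q + 1) / (real q - t + 1))
     \<le> (\<Sum>S\<in>?Z. bexp p ?E (\<lambda>G. real (card (P S G))))"
    using sum_mono[OF P(3)] by simp
  also have "\<dots> = bexp p ?E (\<lambda>G. \<Sum>S\<in>?Z. real (card (P S G)))"
    by (rule bexp_sum[OF p01 finE, symmetric])
  also have "\<dots> \<le> bexp p ?E (\<lambda>G. real (triangle_packing_number ({1..n}, G)))"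
    by (rule bexp_mono[OF p01 finE le])
  finally show ?thesis .
qed

section \<open>From expectation to probability\<close>

lemma prob_binomial_random_graph:
  "measure_pmf.prob (binomial_random_graph n p) A
     = bexp p (vertex_pairs {1..n}) (\<lambda>G. indicator A ({1..n}, G))"
proof -
  let ?M = "Pi_pmf (vertex_pairs {1..n}) False (\<lambda>_. bernoulli_pmf p)"
  let ?g = "\<lambda>f. ({1..n}, {e \<in> vertex_pairs {1..n}. f e})"
  have "measure_pmf.prob (binomial_random_graph n p) A = measure_pmf.prob ?M (?g -` A)"
    by (simp add: binomial_random_graph_def)
  also have "\<dots> = measure_pmf.expectation ?M (indicator (?g -` A))"
    by simp
  also have "\<dots> = bexp p (vertex_pairs {1..n}) (\<lambda>G. indicator A ({1..n}, G))"
    unfolding bexp_def by (intro arg_cong[where f = "measure_pmf.expectation ?M"] ext) (simp add: indicator_def)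
  finally show ?thesis .
qed

lemma prob_packing_number_ge:
  fixes n :: nat and p \<epsilon> :: real
  assumes p01: "0 \<le> p" "p \<le> 1" and m: "m = real (n choose 2) * p" "m > 0" and \<epsilon>: "\<epsilon> > 0"
  shows "measure_pmf.prob (binomial_random_graph n p)
      {G. \<bar>real (triangle_packing_number G) - m / 3\<bar> \<le> \<epsilon> * m}
    \<ge> 1 - (m / 3 - bexp p (vertex_pairs {1..n}) (\<lambda>G. real (triangle_packing_number ({1..n}, G))) + sqrt m / 3) / (\<epsilon> * m)"
proof -
  let ?E = "vertex_pairs {1..n}"
  let ?\<nu> = "\<lambda>G. real (triangle_packing_number ({1..n}, G))"
  have fin: "finite ?E" by simp
  have card_E: "p * card ?E = m" using m(1) by (simp add: card_vertex_pairs)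
  have dev: "bexp p ?E (\<lambda>G. \<bar>real (card G) - m\<bar>) \<le> sqrt m"
    using bexp_abs_dev[OF p01 fin, of "sqrt m"] m(2) unfolding card_E by (simp add: real_div_sqrt)
  have mean: "bexp p ?E (\<lambda>G. real (card G)) = m"
    using bexp_card[OF p01 fin] card_E by simp
  have "bexp p ?E (\<lambda>G. 1 - (1 / (\<epsilon> * m)) * ((1 / 3) * real (card G) - ?\<nu> G + (1 / 3) * \<bar>real (card G) - m\<bar>))
    \<le> bexp p ?E (\<lambda>G. indicator {G. \<bar>real (triangle_packing_number G) - m / 3\<bar> \<le> \<epsilon> * m} ({1..n}, G))"
  proof (rule bexp_mono[OF p01 fin])
    fix G assume G: "G \<subseteq> ?E"
    \<comment> \<open>\<open>D\<close> is nonnegative because three times the packing number is at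
      most \<open>card G\<close>, and it dominates the deviation from \<open>m / 3\<close> by the
      triangle inequality. Hence \<open>1 - D / (\<epsilon> * m)\<close> is at most 1, and at most 0
      outside the event: Markov's inequality in pointwise form.\<close>
    define D where "D = (1 / 3) * real (card G) - ?\<nu> G + (1 / 3) * \<bar>real (card G) - m\<bar>"
    have "3 * ?\<nu> G \<le> real (card G)"
      using triangle_packing_number_le[OF _ G] by simp
    moreover have "0 \<le> (1 / 3) * c - v + (1 / 3) * \<bar>c - m\<bar>" "\<bar>v - m / 3\<bar> \<le> (1 / 3) * c - v + (1 / 3) * \<bar>c - m\<bar>"
      if "3 * v \<le> c" for v c :: real
      using that by (auto simp: abs_if field_simps)
    ultimately have D: "D \<ge> 0" "\<bar>?\<nu> G - m / 3\<bar> \<le> D" unfolding D_def by blast+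
    have "1 - 1 / (\<epsilon> * m) * D \<le> 0" if "D > \<epsilon> * m"
      using that \<epsilon> m(2) by (simp add: field_simps)
    moreover have "1 - 1 / (\<epsilon> * m) * D \<le> 1" using D(1) \<epsilon> m(2) by simp
    ultimately show "1 - 1 / (\<epsilon> * m) * D
        \<le> indicator {G. \<bar>real (triangle_packing_number G) - m / 3\<bar> \<le> \<epsilon> * m} ({1..n}, G)"
      using D(2) by (auto simp: indicator_def)
  qed
  also have "\<dots> = measure_pmf.prob (binomial_random_graph n p) {G. \<bar>real (triangle_packing_number G) - m / 3\<bar> \<le> \<epsilon> * m}"
    by (rule prob_binomial_random_graph[symmetric])
  finally have "1 - (1 / (\<epsilon> * m)) * ((1 / 3) * m - bexp p ?E ?\<nu> + (1 / 3) * bexp p ?E (\<lambda>G. \<bar>real (card G) - m\<bar>))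
     \<le> measure_pmf.prob (binomial_random_graph n p) {G. \<bar>real (triangle_packing_number G) - m / 3\<bar> \<le> \<epsilon> * m}"
    by (simp only: bexp_diff[OF p01 fin] bexp_add[OF p01 fin] bexp_cmult[OF p01 fin] bexp_const[OF p01 fin] mean)
  moreover have "(1 / (\<epsilon> * m)) * ((1 / 3) * m - bexp p ?E ?\<nu> + (1 / 3) * bexp p ?E (\<lambda>G. \<bar>real (card G) - m\<bar>))
     \<le> (1 / (\<epsilon> * m)) * (m / 3 - bexp p ?E ?\<nu> + sqrt m / 3)"
    using dev \<epsilon> m(2) by (intro mult_left_mono) auto
  ultimately show ?thesis by simp
qed

section \<open>Asymptotics\<close>

lemma real_div_bounds:
  "real (a div b) \<le> real a / real b" "real a / real b \<le> real (a div b) + 1"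
  using floor_correct[of "real a / real b"] by (simp_all add: floor_divide_of_nat_eq)

text \<open>\<open>x\<close> is a lower bound for the class size \<open>n div N\<close> without
  rounding. \<beta> bounds from below the share of the \<open>p * q^2\<close> edges between two
  classes that enter triangles: \<open>1 / N\<close> is lost by stopping early, and the last term is
  the shortfall divided by \<open>p * q^2\<close>.\<close>

lemma expected_packing_number_ge_quadratic:
  fixes p x :: real and N n :: nat
  assumes p: "0 < p" "p \<le> 1" and N: "3 \<le> N" and x: "x = n / N - 1" "1 \<le> x"
    and \<beta>: "\<beta> = 1 - 1 / N - 12 * N / (p * sqrt x)" "\<beta> \<ge> 0"
  shows "bexp p (vertex_pairs {1..n}) (\<lambda>G. real (triangle_packing_number ({1..n}, G)))
    \<ge> (real N * (real N - 3) / 6) * (p * x\<^sup>2 * \<beta>)"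
proof -
  define q where "q = n div N"
  \<comment> \<open>Stopping here gives \<open>q - t + 1 \<ge> q / N\<close>, which bounds the
    shortfall by \<open>12 * N * q * sqrt q\<close>; the 12 is the 6 of the recurrence doubled by
    \<open>q + 1 \<le> 2 * q\<close>.\<close>
  define t where "t = q - q div N"
  have q: "N * q \<le> n" by (simp add: q_def)
  have xq: "x \<le> q"
    using real_div_bounds(2)[of n N] unfolding q_def x(1) by linarith
  then have q1: "1 \<le> q" using x(2) by linarith
  have t: "t \<le> q" by (simp add: t_def)
  have rt: "real t = real q - real (q div N)" by (simp add: t_def of_nat_diff)
  have "real (q div N) \<le> q / N" by (rule real_div_bounds)
  then have t1: "real q * (1 - 1 / N) \<le> t" by (simp add: rt algebra_simps)
  have "real q / N \<le> real q - t + 1"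
    using real_div_bounds(2)[of q N] unfolding rt by linarith
  then have "6 * q * sqrt q * (q + 1) / (real q - t + 1) \<le> 6 * q * sqrt q * (q + 1) / (real q / N)"
    using q1 N t by (intro divide_left_mono mult_pos_pos divide_pos_pos) auto
  also have "\<dots> = 6 * N * sqrt q * (real q + 1)" using q1 N by (simp add: field_simps)
  also have "\<dots> \<le> 6 * N * sqrt q * (2 * q)" using q1 by (intro mult_left_mono) auto
  finally have loss: "6 * q * sqrt q * (q + 1) / (real q - t + 1) \<le> 12 * N * q * sqrt q" by (simp add: mult_ac)
  have "x\<^sup>2 * \<beta> \<le> (real q)\<^sup>2 * (1 - 1 / N - 12 * N / (p * sqrt q))"
  proof (intro mult_mono)
    show "x\<^sup>2 \<le> (real q)\<^sup>2" using xq x(2) by (intro power_mono) auto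
    have "12 * N / (p * sqrt q) \<le> 12 * N / (p * sqrt x)"
      using p x(2) xq q1 by (intro divide_left_mono mult_left_mono mult_pos_pos) auto
    then show "\<beta> \<le> 1 - 1 / N - 12 * N / (p * sqrt q)" unfolding \<beta>(1) by linarith
  qed (use \<beta>(2) in auto)
  then have "p * (x\<^sup>2 * \<beta>) \<le> p * ((real q)\<^sup>2 * (1 - 1 / N - 12 * N / (p * sqrt q)))"
    using p by (intro mult_left_mono) auto
  also have "\<dots> = p * (real q * (real q * (1 - 1 / N))) - 12 * N * (real q * (real q / sqrt q))"
    using p by (simp add: algebra_simps power2_eq_square)
  also have "\<dots> = p * (real q * (real q * (1 - 1 / N))) - 12 * N * q * sqrt q"
    by (simp add: real_div_sqrt)
  also have "\<dots> \<le> p * (real q * t) - 12 * N * q * sqrt q"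
    using p t1 by (intro diff_right_mono mult_left_mono) auto
  finally have val: "p * x\<^sup>2 * \<beta> \<le> p * q * t - 6 * q * sqrt q * (q + 1) / (real q - t + 1)"
    using loss by (simp add: mult.assoc)
  have "real (N\<^sup>2) \<le> real (6 * card (zero_sum_triples N) + 3 * N)"
    using card_zero_sum_triples[of N] by (simp only: of_nat_le_iff)
  then have "real N * (real N - 3) / 6 \<le> card (zero_sum_triples N)"
    by (simp add: power2_eq_square algebra_simps)
  then have "(real N * (real N - 3) / 6) * (p * x\<^sup>2 * \<beta>)
      \<le> card (zero_sum_triples N) * (p * q * t - 6 * q * sqrt q * (q + 1) / (real q - t + 1))"
    using val p \<beta>(2) N by (intro mult_mono) auto
  also have "\<dots> \<le> bexp p (vertex_pairs {1..n}) (\<lambda>G. real (triangle_packing_number ({1..n}, G)))"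
    using expected_packing_number_ge[OF p _ q t] q1 by simp
  finally show ?thesis .
qed

text \<open>\<open>N\<close> is chosen from \<delta> alone, before \<open>n\<close> grows: at least
  N(N-3)/6 triples with about p(n/N)^2(1-1/N) triangles each, compared with p n^2/2 edges, give a
  ratio that tends to 1/3 as \<open>N\<close> grows.\<close>

lemma expected_packing_number_asymp:
  fixes p :: "nat \<Rightarrow> real" and \<delta> :: real
  assumes p: "\<And>n. 0 \<le> p n \<and> p n \<le> 1"
    and d: "filterlim (\<lambda>n. (real n - 2) * (p n)\<^sup>2) at_top sequentially" and \<delta>: "\<delta> > 0"
  shows "eventually (\<lambda>n. bexp (p n) (vertex_pairs {1..n}) (\<lambda>G. real (triangle_packing_number ({1..n}, G)))
    \<ge> (1 / 3 - \<delta>) * (real (n choose 2) * p n)) sequentially"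
proof -
  have "((\<lambda>N. (real N * (real N - 3)) / (3 * (real N)\<^sup>2) * (1 - 1 / real N)) \<longlongrightarrow> 1 / 3) sequentially"
    by real_asymp
  then have "eventually (\<lambda>N. (real N * (real N - 3)) / (3 * (real N)\<^sup>2) * (1 - 1 / real N) > 1 / 3 - \<delta>) sequentially"
    using \<delta> by (intro order_tendstoD) auto
  then obtain N where N: "3 \<le> N" "(real N * (real N - 3)) / (3 * (real N)\<^sup>2) * (1 - 1 / real N) > 1 / 3 - \<delta>"
    using eventually_conj[OF eventually_ge_at_top[of 3]] by (metis (mono_tags, lifting) eventually_sequentially le_refl)
  define M where "M = real N"
  have M: "M \<ge> 3" using N(1) by (simp add: M_def)
  define x where "x n = real n / M - 1" for n
  define \<beta> where "\<beta> n = 1 - 1 / M - 12 * M / (p n * sqrt (x n))" for n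
  have x_ge: "eventually (\<lambda>n. x n \<ge> 1) sequentially"
    unfolding x_def using M by real_asymp
  have pos: "eventually (\<lambda>n. (real n - 2) * (p n)\<^sup>2 > 0 \<and> n > 2) sequentially"
    using d by (intro eventually_conj eventually_gt_at_top) (auto simp: filterlim_at_top_dense)
  have "((\<lambda>n. x n / (real n - 2)) \<longlongrightarrow> inverse M) sequentially"
    unfolding x_def using M by real_asymp
  \<comment> \<open>\<open>p * sqrt x\<close> is asymptotically \<open>sqrt (d / M)\<close>, so the
    growth of \<open>d\<close> removes the shortfall term of \<beta> for every fixed
    \<open>M\<close>.\<close>
  then have "filterlim (\<lambda>n. x n / (real n - 2) * ((real n - 2) * (p n)\<^sup>2)) at_top sequentially"
    by (rule filterlim_tendsto_pos_mult_at_top[OF _ _ d]) (use M in simp)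
  then have "filterlim (\<lambda>n. sqrt (x n / (real n - 2) * ((real n - 2) * (p n)\<^sup>2))) at_top sequentially"
    using filterlim_compose[OF sqrt_at_top] by blast
  then have lim: "filterlim (\<lambda>n. p n * sqrt (x n)) at_top sequentially"
  proof (rule filterlim_mono_eventually[OF _ order_refl order_refl])
    show "eventually (\<lambda>n. sqrt (x n / (real n - 2) * ((real n - 2) * (p n)\<^sup>2)) = p n * sqrt (x n)) sequentially"
      using pos
    proof eventually_elim
      case (elim n)
      then have "x n / (real n - 2) * ((real n - 2) * (p n)\<^sup>2) = (p n)\<^sup>2 * x n" by simp
      then show ?case using p by (simp add: real_sqrt_mult)
    qed
  qed
  then have "((\<lambda>n. 12 * M / (p n * sqrt (x n))) \<longlongrightarrow> 0) sequentially"
    by (intro tendsto_divide_0[OF tendsto_const] filterlim_at_top_imp_at_infinity)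
  from tendsto_diff[OF tendsto_const this, of "1 - 1 / M"]
  have \<beta>_lim: "(\<beta> \<longlongrightarrow> 1 - 1 / M) sequentially"
    unfolding \<beta>_def[abs_def] by simp
  have \<beta>_pos: "eventually (\<lambda>n. \<beta> n > 0) sequentially"
    using M by (intro order_tendstoD(1)[OF \<beta>_lim]) auto
  have "((\<lambda>n. (M * (M - 3) / 6) * ((x n)\<^sup>2 / (real n * (real n - 1) / 2))) \<longlongrightarrow> (M * (M - 3)) / (3 * M\<^sup>2)) sequentially"
    unfolding x_def using M by (real_asymp simp: field_simps power2_eq_square)
  from tendsto_mult[OF this \<beta>_lim] N(2)
  have "eventually (\<lambda>n. (M * (M - 3) / 6) * ((x n)\<^sup>2 / (real n * (real n - 1) / 2)) * \<beta> n > 1 / 3 - \<delta>) sequentially"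
    unfolding M_def by (rule order_tendstoD)
  with x_ge pos \<beta>_pos show ?thesis
  proof eventually_elim
    case (elim n)
    have pn: "0 < p n" "p n \<le> 1" using elim(2) p[of n] by (auto simp: less_le)
    have ch: "real (n choose 2) = real n * (real n - 1) / 2"
      using elim(2) by (simp add: choose_two real_of_nat_div of_nat_diff)
    have ch_pos: "real (n choose 2) > 0" using elim(2) unfolding ch by simp
    have "(1 / 3 - \<delta>) * (real (n choose 2) * p n)
       \<le> (M * (M - 3) / 6) * ((x n)\<^sup>2 / real (n choose 2)) * \<beta> n * (real (n choose 2) * p n)"
      using elim(4) pn ch_pos unfolding ch by (intro mult_right_mono) auto
    also have "\<dots> = (M * (M - 3) / 6) * (p n * (x n)\<^sup>2 * \<beta> n)" using ch_pos by simp
    also have "\<dots> \<le> bexp (p n) (vertex_pairs {1..n}) (\<lambda>G. real (triangle_packing_number ({1..n}, G)))"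
      using expected_packing_number_ge_quadratic[OF pn N(1), of "x n" n "\<beta> n"] elim(1,3) by (simp add: M_def x_def \<beta>_def)
    finally show ?case .
  qed
qed

theorem theorem1p7:
  fixes p m d :: "nat \<Rightarrow> real"
  assumes p: "\<And>n. 0 \<le> p n \<and> p n \<le> 1"
    and m: "\<And>n. m n = real (n choose 2) * p n"
    and d: "\<And>n. d n = (real n - 2) * (p n)\<^sup>2"
    and d_lim: "filterlim d at_top sequentially"
  shows "\<forall>\<epsilon>>0. (\<lambda>n. measure_pmf.prob (binomial_random_graph n (p n))
            {G. \<bar>real (triangle_packing_number G) - m n / 3\<bar> \<le> \<epsilon> * m n})
          \<longlonglongrightarrow> 1"
proof (intro allI impI)
  fix \<epsilon> :: real assume \<epsilon>: "\<epsilon> > 0"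
  let ?\<nu> = "\<lambda>n. bexp (p n) (vertex_pairs {1..n}) (\<lambda>G. real (triangle_packing_number ({1..n}, G)))"
  have d_lim': "filterlim (\<lambda>n. (real n - 2) * (p n)\<^sup>2) at_top sequentially"
    using d_lim unfolding d[abs_def] .
  \<comment> \<open>The mean number of edges therefore tends to infinity, and its fluctuation, of
    order \<open>sqrt m\<close>, is negligible against \<open>m\<close>.\<close>
  have m_ge: "m n \<ge> d n" if "n > 2" for n
  proof -
    have "real (n choose 2) = real n * (real n - 1) / 2"
      using that by (simp add: choose_two real_of_nat_div of_nat_diff)
    moreover have "(real n - 2) * 2 \<le> real n * (real n - 1)"
      using that by (intro mult_mono) auto
    ultimately have "real n - 2 \<le> real (n choose 2)"
      by (simp only: le_divide_eq_numeral1(1))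
    moreover have "(p n)\<^sup>2 \<le> p n"
      using p[of n] by (simp add: power2_eq_square mult_left_le)
    ultimately show ?thesis unfolding m d using that p[of n] by (intro mult_mono) auto
  qed
  have m_lim: "filterlim m at_top sequentially"
    using d_lim eventually_mono[OF eventually_gt_at_top[of 2] m_ge] by (rule filterlim_at_top_mono)
  have sqrt_lim: "((\<lambda>n. 1 / sqrt (m n)) \<longlongrightarrow> 0) sequentially"
    by (intro tendsto_divide_0[OF tendsto_const] filterlim_at_top_imp_at_infinity
        filterlim_compose[OF sqrt_at_top m_lim])
  show "(\<lambda>n. measure_pmf.prob (binomial_random_graph n (p n))
            {G. \<bar>real (triangle_packing_number G) - m n / 3\<bar> \<le> \<epsilon> * m n}) \<longlonglongrightarrow> 1"
  proof (rule order_tendstoI)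
    fix y :: real assume "y > 1"
    then show "eventually (\<lambda>n. measure_pmf.prob (binomial_random_graph n (p n))
            {G. \<bar>real (triangle_packing_number G) - m n / 3\<bar> \<le> \<epsilon> * m n} < y) sequentially"
      by (intro always_eventually allI) (meson le_less_trans measure_pmf.prob_le_1)
  next
    fix y :: real assume y: "y < 1"
    \<comment> \<open>Two errors, each below \<open>\<delta> * m\<close>, must add up to less than
      \<open>(1 - y) * \<epsilon> * m\<close>: one from the expectation, one from the number of
      edges.\<close>
    define \<delta> where "\<delta> = \<epsilon> * (1 - y) / 2"
    have \<delta>: "\<delta> > 0" using \<epsilon> y by (simp add: \<delta>_def)
    have 1: "eventually (\<lambda>n. ?\<nu> n \<ge> (1 / 3 - \<delta>) * (real (n choose 2) * p n)) sequentially"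
      by (rule expected_packing_number_asymp[OF p d_lim' \<delta>])
    have 2: "eventually (\<lambda>n. 1 / sqrt (m n) < \<delta>) sequentially"
      using order_tendstoD(2)[OF sqrt_lim \<delta>] .
    have 3: "eventually (\<lambda>n. m n > 0) sequentially"
      using m_lim by (simp add: filterlim_at_top_dense)
    show "eventually (\<lambda>n. y < measure_pmf.prob (binomial_random_graph n (p n))
            {G. \<bar>real (triangle_packing_number G) - m n / 3\<bar> \<le> \<epsilon> * m n}) sequentially"
      using 1 2 3
    proof eventually_elim
      case (elim n)
      have "sqrt (m n) = m n * (1 / sqrt (m n))" using elim(3) by (simp add: real_div_sqrt)
      also have "\<dots> < m n * \<delta>" using elim(2,3) by (intro mult_strict_left_mono)
      finally have sqrt_less: "sqrt (m n) < m n * \<delta>" .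
      have "m n / 3 - m n * \<delta> \<le> ?\<nu> n"
        using elim(1) unfolding m[symmetric] by (simp add: algebra_simps)
      moreover have "0 < m n * \<delta>" using elim(3) \<delta> by simp
      ultimately have less: "m n / 3 - ?\<nu> n + sqrt (m n) / 3 < 2 * \<delta> * m n"
        using sqrt_less by (simp only: mult.assoc mult.commute[of \<delta>])
      have "(m n / 3 - ?\<nu> n + sqrt (m n) / 3) / (\<epsilon> * m n) < 1 - y"
      proof -
        have "2 * \<delta> * m n = (1 - y) * (\<epsilon> * m n)" by (simp add: \<delta>_def)
        moreover have "0 < \<epsilon> * m n" using elim(3) \<epsilon> by simp
        ultimately show ?thesis
          using less by (simp only: pos_divide_less_eq)
      qed
      then show ?case
        using prob_packing_number_ge[OF _ _ m elim(3) \<epsilon>] p[of n] by (smt (verit))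
    qed
  qed
qed

end
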